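(* Let $G$ be a commutative-transitive discrete group. Then $H^n(\ell^1(G),I_0(G)')=0$ for every $n\ge1$.
   Context: For a discrete group $G$, $\ell^1(G)$ is its convolution algebra with standard basis $(e_g)_{g\in G}$; the augmentation character $\varepsilon:\ell^1(G)\to\mathbb C$ sends each $e_g$ to $1$, and the augmentation ideal is $I_0(G)=\ker\varepsilon$, a Banach $\ell^1(G)$-bimodule under multiplication; $I_0(G)'$ is its dual with the adjoint bimodule structure. $G$ is commutative-transitive if the centralizer of every element of $G\setminus\{e\}$ is abelian. $H^n(A,M)$ denotes Hochschild cohomology of the Banach algebra $A$ with coefficients in the Banach bimodule $M$, computed from the complex of bounded $n$-linear maps $A^n\to M$ with the standard Hochschild coboundary. *)

theory Defs
  imports "HOL-Analysis.Analysis" "HOL-Algebra.Group"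
begin

definition comm_transitive :: "('g, 'b) monoid_scheme \<Rightarrow> bool" where
  "comm_transitive G \<longleftrightarrow>
     (\<forall>x\<in>carrier G - {\<one>\<^bsub>G\<^esub>}. \<forall>y\<in>carrier G. \<forall>z\<in>carrier G.
        y \<otimes>\<^bsub>G\<^esub> x = x \<otimes>\<^bsub>G\<^esub> y \<longrightarrow> z \<otimes>\<^bsub>G\<^esub> x = x \<otimes>\<^bsub>G\<^esub> z \<longrightarrow>
        y \<otimes>\<^bsub>G\<^esub> z = z \<otimes>\<^bsub>G\<^esub> y)"

definition l1 :: "('g, 'b) monoid_scheme \<Rightarrow> ('g \<Rightarrow> complex) set" where
  "l1 G = {f. (\<forall>x. x \<notin> carrier G \<longrightarrow> f x = 0) \<and> (\<lambda>x. norm (f x)) summable_on carrier G}"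

definition l1norm :: "('g, 'b) monoid_scheme \<Rightarrow> ('g \<Rightarrow> complex) \<Rightarrow> real" where
  "l1norm G f = (\<Sum>\<^sub>\<infinity>x\<in>carrier G. norm (f x))"

definition conv :: "('g, 'b) monoid_scheme \<Rightarrow> ('g \<Rightarrow> complex) \<Rightarrow> ('g \<Rightarrow> complex) \<Rightarrow> ('g \<Rightarrow> complex)" where
  "conv G f h = (\<lambda>x. if x \<in> carrier G
       then (\<Sum>\<^sub>\<infinity>y\<in>carrier G. f y * h (inv\<^bsub>G\<^esub> y \<otimes>\<^bsub>G\<^esub> x)) else 0)"

definition aug_ideal :: "('g, 'b) monoid_scheme \<Rightarrow> ('g \<Rightarrow> complex) set" where
  "aug_ideal G = {f \<in> l1 G. (\<Sum>\<^sub>\<infinity>x\<in>carrier G. f x) = 0}"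

text \<open>A bounded n-cochain with values in I_0(G)': T maps a list of n elements of l1(G)
  to a functional on I_0(G); it must be linear in each slot, and jointly bounded.
  (Its values T as are then bounded linear functionals on I_0(G), i.e. elements of I_0(G)'.)\<close>
definition cochain ::
  "('g, 'b) monoid_scheme \<Rightarrow> nat \<Rightarrow> (('g \<Rightarrow> complex) list \<Rightarrow> ('g \<Rightarrow> complex) \<Rightarrow> complex) \<Rightarrow> bool" where
  "cochain G n T \<longleftrightarrow>
     (\<forall>as. set as \<subseteq> l1 G \<longrightarrow> length as = n \<longrightarrow>
        (\<forall>i<n. \<forall>a\<in>l1 G. \<forall>b\<in>l1 G. \<forall>c::complex. \<forall>x\<in>aug_ideal G.
           T (as[i := (\<lambda>g. c * a g + b g)]) x = c * T (as[i := a]) x + T (as[i := b]) x) \<and>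
        (\<forall>x\<in>aug_ideal G. \<forall>y\<in>aug_ideal G. \<forall>c::complex.
           T as (\<lambda>g. c * x g + y g) = c * T as x + T as y)) \<and>
     (\<exists>C. \<forall>as. set as \<subseteq> l1 G \<longrightarrow> length as = n \<longrightarrow> (\<forall>x\<in>aug_ideal G.
        norm (T as x) \<le> C * prod_list (map (l1norm G) as) * l1norm G x))"

text \<open>Hochschild coboundary of an n-cochain, evaluated at (a_1,...,a_{n+1}) and x in I_0(G).
  Dual module actions: (a.phi)(x) = phi(x*a), (phi.a)(x) = phi(a*x).\<close>
definition cobdry ::
  "('g, 'b) monoid_scheme \<Rightarrow> nat \<Rightarrow> (('g \<Rightarrow> complex) list \<Rightarrow> ('g \<Rightarrow> complex) \<Rightarrow> complex)
     \<Rightarrow> ('g \<Rightarrow> complex) list \<Rightarrow> ('g \<Rightarrow> complex) \<Rightarrow> complex" where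
  "cobdry G n T as x =
     T (tl as) (conv G x (hd as))
     + (\<Sum>i<n. (-1) ^ (i + 1) *
          T (take i as @ [conv G (as ! i) (as ! (i + 1))] @ drop (i + 2) as) x)
     + (-1) ^ (n + 1) * T (take n as) (conv G (as ! n) x)"

end

theory Submission
  imports Defs
begin

text \<open>Write e(g) for the basis vectors and put
  t(g1,...,gn,y) = T(e(g1),...,e(gn))(e(y) - e(z)) with z the inverse of g1...gn.
  Then t satisfies a cyclically symmetric cocycle identity on G, and it vanishes when the total
  product x = g1...gn y is trivial.  Every face map of the identity preserves the conjugacy class of
  x, so for x different from 1 one may average over the centralizer of x, which is abelian and hence
  has an invariant mean.  Choosing the means m(x) so that they are equivariant under conjugation, the
  bounded function s(g1,...,g(n-1),y) = m(x)[h -> t(h^-1,g1,...,g(n-1),yh)], x = g1...g(n-1)y, has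
  coboundary t.  Both t and s extend from group elements to l1(G) by (iterated) absolutely convergent
  sums, and T is recovered from t because the differences e(y) - e(z) span I_0(G).\<close>

section \<open>Conjugation-equivariant means\<close>

text \<open>The obstacle is that \<open>G\<close> need not be amenable: nonabelian free groups are
  commutative-transitive. No mean invariant under all of \<open>G\<close> is available, so the
  averaging has to be done one conjugacy class at a time, with a mean on \<open>G\<close> that is
  invariant only under the centralizer of \<open>x\<close>. Equivariance m(g x g^-1)[\<phi>] =
  m(x)[h -> \<phi>(gh)] contains this invariance, as one sees by taking g in the centralizer, and it
  is needed because the face that moves g1 to the end replaces the total product x by g1^-1 x g1.
  The class of 1 cannot be treated in this way, its centralizer being \<open>G\<close> itself; with
  \<ell>^1(G) in place of I_0(G) it would contribute the bounded cohomology of \<open>G\<close>.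
  Here it is removed by a normalization: a functional on I_0(G) is a bounded function on
  \<open>G\<close> modulo constants, and subtracting its value at z selects the representative that
  is zero exactly where the total product is 1 requires it. The choice is compatible with all faces,
  so the cocycle identity survives it.\<close>

text \<open>A mean is total on functions, so it is pinned to 0 on unbounded ones; this makes the set of
  means compact in the product topology.\<close>

definition mean :: "('g, 'b) monoid_scheme \<Rightarrow> (('g \<Rightarrow> complex) \<Rightarrow> complex) \<Rightarrow> bool" where
  "mean G m \<longleftrightarrow>
     (\<forall>\<phi> K. (\<forall>h\<in>carrier G. norm (\<phi> h) \<le> K) \<longrightarrow> norm (m \<phi>) \<le> K) \<and>
     (\<forall>\<phi> \<psi> c. bounded (\<phi> ` carrier G) \<longrightarrow> bounded (\<psi> ` carrier G) \<longrightarrow>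
        m (\<lambda>h. c * \<phi> h + \<psi> h) = c * m \<phi> + m \<psi>) \<and>
     m (\<lambda>_. 1) = 1 \<and>
     (\<forall>\<phi>. \<not> bounded (\<phi> ` carrier G) \<longrightarrow> m \<phi> = 0)"

lemma closed_mean: "closed {m. mean G m}"
  unfolding mean_def
  by (intro closed_Collect_conj closed_Collect_all closed_Collect_imp open_Collect_const
      closed_Collect_le closed_Collect_eq continuous_intros continuous_on_product_coordinates)

lemma compact_mean: "compact {m. mean G m}"
proof -
  define b :: "('a \<Rightarrow> complex) \<Rightarrow> real"
    where "b = (\<lambda>\<phi>. SOME K. \<forall>h\<in>carrier G. norm (\<phi> h) \<le> K)"
  have b: "\<forall>h\<in>carrier G. norm (\<phi> h) \<le> b \<phi>" if "bounded (\<phi> ` carrier G)" for \<phi>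
    unfolding b_def by (rule someI_ex) (use that in \<open>auto simp: bounded_iff\<close>)
  \<comment> \<open>A Tychonoff product of balls. For unbounded \<phi> the chosen
    \<open>b \<phi>\<close> is arbitrary, possibly negative; the \<open>max\<close> keeps the centre
    0, the prescribed value there, inside the ball.\<close>
  let ?P = "PiE UNIV (\<lambda>\<phi>::'a \<Rightarrow> complex. cball (0::complex) (max 0 (b \<phi>)))"
  have "compactin (product_topology (\<lambda>_. euclidean) UNIV) ?P"
    by (subst compactin_PiE) auto
  then have "compact ?P"
    by (simp add: euclidean_product_topology)
  moreover have "{m. mean G m} \<subseteq> ?P"
  proof
    fix m :: "('a \<Rightarrow> complex) \<Rightarrow> complex" assume "m \<in> {m. mean G m}"
    then have m: "mean G m" by simp
    have "norm (m \<phi>) \<le> max 0 (b \<phi>)" for \<phi>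
    proof (cases "bounded (\<phi> ` carrier G)")
      case True
      then have "norm (m \<phi>) \<le> b \<phi>" using m b unfolding mean_def by blast
      then show ?thesis by simp
    next
      case False
      then have "m \<phi> = 0" using m unfolding mean_def by blast
      then show ?thesis by simp
    qed
    then show "m \<in> ?P" by auto
  qed
  ultimately show ?thesis
    using closed_mean compact_Int_closed by (metis inf.absorb_iff2)
qed

section \<open>Calculus of means: linearity, translation, averaging\<close>

lemma bounded_scale:
  fixes \<phi> :: "'a \<Rightarrow> complex"
  assumes "bounded (\<phi> ` A)"
  shows "bounded ((\<lambda>h. c * \<phi> h) ` A)"
proof -
  obtain K where "\<forall>x\<in>A. norm (\<phi> x) \<le> K" using assms by (auto simp: bounded_iff)
  then have "\<forall>x\<in>A. norm (c * \<phi> x) \<le> norm c * K"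
    by (simp add: norm_mult mult_left_mono)
  then show ?thesis by (auto simp: bounded_iff)
qed

context group
begin

lemma bounded_translate:
  assumes "bounded (\<phi> ` carrier G)" "c \<in> carrier G"
  shows "bounded ((\<lambda>h. \<phi> (c \<otimes> h)) ` carrier G)"
  by (rule bounded_subset[OF assms(1)]) (use assms(2) in auto)

lemma bounded_translate_iff:
  assumes "c \<in> carrier G"
  shows "bounded ((\<lambda>h. \<phi> (c \<otimes> h)) ` carrier G) \<longleftrightarrow> bounded (\<phi> ` carrier G)"
proof -
  have "(\<lambda>h. \<phi> (c \<otimes> h)) ` carrier G = \<phi> ` carrier G"
    using surj_const_mult[OF assms] by (metis (no_types) image_image)
  then show ?thesis by simp
qed

lemma mean_lin:
  assumes "mean G m" "bounded (\<phi> ` carrier G)" "bounded (\<psi> ` carrier G)"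
  shows "m (\<lambda>h. c * \<phi> h + \<psi> h) = c * m \<phi> + m \<psi>"
  using assms unfolding mean_def by blast

lemma mean_le:
  assumes "mean G m" "\<And>h. h \<in> carrier G \<Longrightarrow> norm (\<phi> h) \<le> K"
  shows "norm (m \<phi>) \<le> K"
  using assms unfolding mean_def by blast

text \<open>Arguments of a mean are total functions, so it must be shown that values off the carrier
  do not matter: the difference of the two functions is bounded by 0 on the carrier.\<close>

lemma mean_cong:
  assumes "mean G m" "\<And>h. h \<in> carrier G \<Longrightarrow> \<phi> h = \<psi> h"
  shows "m \<phi> = m \<psi>"
proof (cases "bounded (\<phi> ` carrier G)")
  case True
  moreover have eq: "\<phi> ` carrier G = \<psi> ` carrier G" using assms(2) by auto
  ultimately have "m (\<lambda>h. (-1) * \<psi> h + \<phi> h) = -1 * m \<psi> + m \<phi>"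
    by (intro mean_lin[OF assms(1)]) simp_all
  moreover have "norm (m (\<lambda>h. (-1) * \<psi> h + \<phi> h)) \<le> 0"
    by (rule mean_le[OF assms(1)]) (simp add: assms(2))
  ultimately show ?thesis by simp
next
  case False
  moreover have eq: "\<phi> ` carrier G = \<psi> ` carrier G" using assms(2) by auto
  ultimately show ?thesis using assms(1) unfolding mean_def by metis
qed

lemma mean_const: "mean G m \<Longrightarrow> m (\<lambda>_. c) = c"
proof -
  assume m: "mean G m"
  have *: "bounded ((\<lambda>_. k) ` carrier G)" for k :: complex
    by (auto simp: bounded_iff)
  have "norm (m (\<lambda>_. 0)) \<le> 0" by (rule mean_le[OF m]) simp
  moreover have "m (\<lambda>_. c * 1 + 0) = c * m (\<lambda>_. 1) + m (\<lambda>_. 0)"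
    by (rule mean_lin[OF m * *])
  moreover have "m (\<lambda>_. 1) = 1" using m unfolding mean_def by blast
  ultimately show ?thesis by simp
qed

text \<open>Boundedness of the sum is proved in the same induction because linearity of a mean is
  available on bounded functions only.\<close>

lemma mean_sum:
  assumes "mean G m" "finite I" "\<And>i. i \<in> I \<Longrightarrow> bounded (\<phi> i ` carrier G)"
  shows "bounded ((\<lambda>h. \<Sum>i\<in>I. c i * \<phi> i h) ` carrier G)
    \<and> m (\<lambda>h. \<Sum>i\<in>I. c i * \<phi> i h) = (\<Sum>i\<in>I. c i * m (\<phi> i))"
  using assms(2,3)
proof (induction I)
  case empty
  have "bounded ((\<lambda>h. 0 :: complex) ` carrier G)"
    by (auto simp: bounded_iff)
  then show ?case using mean_const[OF assms(1), of 0] by simp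
next
  case (insert i I)
  have "bounded ((\<lambda>h. c i * \<phi> i h) ` carrier G)"
    using insert.prems[of i] by (intro bounded_scale) auto
  then have "bounded ((\<lambda>h. c i * \<phi> i h + (\<Sum>i\<in>I. c i * \<phi> i h)) ` carrier G)"
    using insert by (intro bounded_plus_comp) auto
  then show ?case
    using insert mean_lin[OF assms(1), of "\<phi> i" "\<lambda>h. \<Sum>i\<in>I. c i * \<phi> i h" "c i"] by simp
qed

lemma mean_translate:
  assumes "mean G m" "c \<in> carrier G"
  shows "mean G (\<lambda>\<phi>. m (\<lambda>h. \<phi> (c \<otimes> h)))"
  unfolding mean_def
proof (intro conjI allI impI)
  fix \<phi> :: "'a \<Rightarrow> complex" and K assume "\<forall>h\<in>carrier G. norm (\<phi> h) \<le> K"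
  then show "norm (m (\<lambda>h. \<phi> (c \<otimes> h))) \<le> K"
    by (intro mean_le[OF assms(1)]) (use assms(2) in auto)
next
  fix \<phi> \<psi> :: "'a \<Rightarrow> complex" and d assume "bounded (\<phi> ` carrier G)" "bounded (\<psi> ` carrier G)"
  then show "m (\<lambda>h. d * \<phi> (c \<otimes> h) + \<psi> (c \<otimes> h))
      = d * m (\<lambda>h. \<phi> (c \<otimes> h)) + m (\<lambda>h. \<psi> (c \<otimes> h))"
    by (intro mean_lin[OF assms(1)] bounded_translate assms(2))
next
  show "m (\<lambda>h. 1) = 1" by (rule mean_const[OF assms(1)])
next
  fix \<phi> :: "'a \<Rightarrow> complex" assume "\<not> bounded (\<phi> ` carrier G)"
  then have "\<not> bounded ((\<lambda>h. \<phi> (c \<otimes> h)) ` carrier G)"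
    using bounded_translate_iff assms(2) by blast
  then show "m (\<lambda>h. \<phi> (c \<otimes> h)) = 0" using assms(1) unfolding mean_def by blast
qed

lemma mean_average:
  assumes "\<And>j. j < Suc N \<Longrightarrow> mean G (m j)"
  shows "mean G (\<lambda>\<phi>. (\<Sum>j<Suc N. m j \<phi>) / of_nat (Suc N))"
  unfolding mean_def
proof (intro conjI allI impI)
  fix \<phi> :: "'a \<Rightarrow> complex" and K assume *: "\<forall>h\<in>carrier G. norm (\<phi> h) \<le> K"
  have "norm (\<Sum>j<Suc N. m j \<phi>) \<le> (\<Sum>j<Suc N. norm (m j \<phi>))" by (rule norm_sum)
  also have "\<dots> \<le> (\<Sum>j<Suc N. K)"
    by (rule sum_mono) (use * mean_le[OF assms] in auto)
  finally have "norm (\<Sum>j<Suc N. m j \<phi>) \<le> K * real (Suc N)" by (simp add: mult.commute)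
  then show "norm ((\<Sum>j<Suc N. m j \<phi>) / of_nat (Suc N)) \<le> K"
    by (simp add: norm_divide pos_divide_le_eq del: of_nat_Suc)
next
  fix \<phi> \<psi> :: "'a \<Rightarrow> complex" and c assume *: "bounded (\<phi> ` carrier G)" "bounded (\<psi> ` carrier G)"
  have "(\<Sum>j<Suc N. m j (\<lambda>h. c * \<phi> h + \<psi> h)) = (\<Sum>j<Suc N. c * m j \<phi> + m j \<psi>)"
    by (rule sum.cong) (use * mean_lin[OF assms] in auto)
  then show "(\<Sum>j<Suc N. m j (\<lambda>h. c * \<phi> h + \<psi> h)) / of_nat (Suc N)
     = c * ((\<Sum>j<Suc N. m j \<phi>) / of_nat (Suc N)) + (\<Sum>j<Suc N. m j \<psi>) / of_nat (Suc N)"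
    by (simp add: sum.distrib sum_distrib_left add_divide_distrib del: sum.lessThan_Suc of_nat_Suc)
next
  have "(\<Sum>j<Suc N. m j (\<lambda>_. 1)) = (\<Sum>j<Suc N. 1)"
    by (rule sum.cong) (use mean_const[OF assms] in auto)
  then show "(\<Sum>j<Suc N. m j (\<lambda>_. 1)) / of_nat (Suc N) = 1"
    by (simp del: of_nat_Suc sum.lessThan_Suc)
next
  fix \<phi> :: "'a \<Rightarrow> complex" assume "\<not> bounded (\<phi> ` carrier G)"
  then have "(\<Sum>j<Suc N. m j \<phi>) = (\<Sum>j<Suc N. 0)"
    by (intro sum.cong) (use assms in \<open>auto simp: mean_def\<close>)
  then show "(\<Sum>j<Suc N. m j \<phi>) / of_nat (Suc N) = 0" by simp
qed

lemma mean_exists: "\<exists>m. mean G m"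
proof
  have *: "bounded ((\<lambda>h. c * \<phi> h + \<psi> h) ` carrier G)"
    if "bounded (\<phi> ` carrier G)" "bounded (\<psi> ` carrier G)" for \<phi> \<psi> :: "'a \<Rightarrow> complex" and c
  proof -
    have "bounded ((\<lambda>h. c * \<phi> h) ` carrier G)"
      using that(1) by (rule bounded_scale)
    then show ?thesis using that(2) by (intro bounded_plus_comp) auto
  qed
  \<comment> \<open>The point mass at the identity, cut off to 0 on unbounded functions.\<close>
  show "mean G (\<lambda>\<phi>. if bounded (\<phi> ` carrier G) then \<phi> \<one> else 0)"
    unfolding mean_def
  proof (intro conjI allI impI)
    fix \<phi> :: "'a \<Rightarrow> complex" and K assume "\<forall>h\<in>carrier G. norm (\<phi> h) \<le> K"
    then have "norm (\<phi> \<one>) \<le> K" by simp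
    moreover have "0 \<le> K" using calculation norm_ge_zero order_trans by blast
    ultimately show "norm (if bounded (\<phi> ` carrier G) then \<phi> \<one> else 0) \<le> K" by simp
  next
    have "bounded ((\<lambda>_. 1 :: complex) ` carrier G)" by (auto simp: bounded_iff)
    then show "(if bounded ((\<lambda>_. 1 :: complex) ` carrier G) then 1 else 0) = (1 :: complex)" by simp
  qed (use * in simp_all)
qed

text \<open>Averaging a mean over translates by the first N+1 powers of c gives such a mean, and for
  commuting elements the averaging preserves the defect already achieved for the others; compactness
  then yields exact invariance.\<close>

definition almost_invariant :: "(('a \<Rightarrow> complex) \<Rightarrow> complex) \<Rightarrow> 'a \<Rightarrow> nat \<Rightarrow> bool" where
  "almost_invariant m c N \<longleftrightarrow>
     (\<forall>\<phi> K. (\<forall>h\<in>carrier G. norm (\<phi> h) \<le> K) \<longrightarrow>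
        real (Suc N) * norm (m (\<lambda>h. \<phi> (c \<otimes> h)) - m \<phi>) \<le> 2 * K)"

lemma closed_almost_invariant: "closed {m. almost_invariant m c N}"
  unfolding almost_invariant_def
  by (intro closed_Collect_all closed_Collect_imp open_Collect_const
      closed_Collect_le continuous_intros continuous_on_product_coordinates)

lemma almost_invariant_exists:
  assumes "finite I" "I \<subseteq> C \<times> UNIV" "C \<subseteq> carrier G"
    and comm: "\<And>c d. c \<in> C \<Longrightarrow> d \<in> C \<Longrightarrow> c \<otimes> d = d \<otimes> c"
  shows "\<exists>m. mean G m \<and> (\<forall>(c, N)\<in>I. almost_invariant m c N)"
  using assms(1,2)
proof (induction I)
  case empty
  then show ?case using mean_exists by simp
next
  case (insert i I)
  obtain d N where i: "i = (d, N)" by fastforce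
  have d: "d \<in> C" "d \<in> carrier G" using insert.prems assms(3) i by auto
  obtain m where m: "mean G m" and inv: "\<forall>(c, N)\<in>I. almost_invariant m c N"
    using insert by auto
  define mm where "mm = (\<lambda>\<phi>. (\<Sum>j<Suc N. m (\<lambda>h. \<phi> (d [^] j \<otimes> h))) / of_nat (Suc N))"
  have "mean G mm"
    unfolding mm_def by (intro mean_average mean_translate[OF m] nat_pow_closed d)
  moreover have "almost_invariant mm d N"
    unfolding almost_invariant_def
  proof (intro allI impI)
    fix \<phi> :: "'a \<Rightarrow> complex" and K assume *: "\<forall>h\<in>carrier G. norm (\<phi> h) \<le> K"
    \<comment> \<open>Translating by d raises each power by one, so the defect telescopes to the
      terms with powers N+1 and 0. Each is at most K in norm, whence the constant 2K in
      \<open>almost_invariant\<close>.\<close>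
    have "(\<Sum>j<Suc N. m (\<lambda>h. \<phi> (d \<otimes> (d [^] j \<otimes> h)))) = (\<Sum>j<Suc N. m (\<lambda>h. \<phi> (d [^] Suc j \<otimes> h)))"
      by (intro sum.cong mean_cong[OF m] arg_cong[where f=\<phi>] refl)
        (metis d(2) m_assoc nat_pow_Suc2 nat_pow_closed)
    then have "of_nat (Suc N) * (mm (\<lambda>h. \<phi> (d \<otimes> h)) - mm \<phi>)
        = (\<Sum>j<Suc N. m (\<lambda>h. \<phi> (d [^] Suc j \<otimes> h)) - m (\<lambda>h. \<phi> (d [^] j \<otimes> h)))"
      unfolding mm_def
      by (simp add: diff_divide_distrib[symmetric] sum_subtractf del: of_nat_Suc sum.lessThan_Suc)
    also have "\<dots> = m (\<lambda>h. \<phi> (d [^] Suc N \<otimes> h)) - m (\<lambda>h. \<phi> (d [^] (0::nat) \<otimes> h))"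
      by (rule sum_lessThan_telescope)
    finally have "norm (of_nat (Suc N) * (mm (\<lambda>h. \<phi> (d \<otimes> h)) - mm \<phi>))
      \<le> norm (m (\<lambda>h. \<phi> (d [^] Suc N \<otimes> h))) + norm (m (\<lambda>h. \<phi> (d [^] (0::nat) \<otimes> h)))"
      using norm_triangle_ineq4 by metis
    also have "\<dots> \<le> K + K"
      by (intro add_mono mean_le[OF m]) (use * d in auto)
    finally show "real (Suc N) * norm (mm (\<lambda>h. \<phi> (d \<otimes> h)) - mm \<phi>) \<le> 2 * K"
      by (simp add: norm_mult del: of_nat_Suc)
  qed
  moreover have "almost_invariant mm c M" if "(c, M) \<in> I" for c M
    unfolding almost_invariant_def
  proof (intro allI impI)
    fix \<phi> :: "'a \<Rightarrow> complex" and K assume *: "\<forall>h\<in>carrier G. norm (\<phi> h) \<le> K"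
    have c: "c \<in> C" "c \<in> carrier G" using that insert.prems assms(3) by auto
    have ai: "almost_invariant m c M" using inv that by auto
    \<comment> \<open>Since c commutes with the powers of d, \<open>a j\<close> is the c-defect of
      the old mean on a d-translate of \<phi>, which obeys the same bound K. An average of such
      defects is no larger.\<close>
    define a where "a j = m (\<lambda>h. \<phi> (c \<otimes> (d [^] j \<otimes> h))) - m (\<lambda>h. \<phi> (d [^] j \<otimes> h))" for j :: nat
    have a: "real (Suc M) * norm (a j) \<le> 2 * K" for j
    proof -
      have "c \<otimes> d [^] j = d [^] j \<otimes> c"
        using comm[OF c(1) d(1)] c d by (metis group_commutes_pow)
      then have "m (\<lambda>h. \<phi> (c \<otimes> (d [^] j \<otimes> h))) = m (\<lambda>h. \<phi> (d [^] j \<otimes> (c \<otimes> h)))"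
        by (intro mean_cong[OF m] arg_cong[where f=\<phi>]) (metis c(2) d(2) m_assoc nat_pow_closed)
      moreover have "\<forall>h\<in>carrier G. norm (\<phi> (d [^] j \<otimes> h)) \<le> K" using * d by auto
      ultimately show ?thesis
        using ai[unfolded almost_invariant_def, rule_format, of "\<lambda>h. \<phi> (d [^] j \<otimes> h)" K]
        unfolding a_def by simp
    qed
    have "real (Suc N) * (real (Suc M) * norm (mm (\<lambda>h. \<phi> (c \<otimes> h)) - mm \<phi>))
        = real (Suc M) * norm (of_nat (Suc N) * (mm (\<lambda>h. \<phi> (c \<otimes> h)) - mm \<phi>))"
      by (simp add: norm_mult del: of_nat_Suc)
    also have "of_nat (Suc N) * (mm (\<lambda>h. \<phi> (c \<otimes> h)) - mm \<phi>) = (\<Sum>j<Suc N. a j)"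
      unfolding mm_def a_def
      by (simp add: diff_divide_distrib[symmetric] sum_subtractf del: of_nat_Suc sum.lessThan_Suc)
    also have "real (Suc M) * norm (\<Sum>j<Suc N. a j) \<le> (\<Sum>j<Suc N. real (Suc M) * norm (a j))"
      unfolding sum_distrib_left[symmetric] by (intro mult_left_mono norm_sum) auto
    also have "\<dots> \<le> (\<Sum>j<Suc N. 2 * K)" by (rule sum_mono) (rule a)
    also have "\<dots> = real (Suc N) * (2 * K)" by simp
    finally show "real (Suc M) * norm (mm (\<lambda>h. \<phi> (c \<otimes> h)) - mm \<phi>) \<le> 2 * K"
      by (simp add: mult_le_cancel_left_pos del: of_nat_Suc)
  qed
  ultimately show ?case using i by (intro exI[of _ mm]) auto
qed

text \<open>A Markov-Kakutani argument. The closed conditions are indexed by pairs (c, N), finitely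
  many of them can be met at once, and by compactness some mean meets all. The conditions for every
  N together force the defect at c to be 0.\<close>

lemma invariant_mean_exists:
  assumes "C \<subseteq> carrier G" "\<And>c d. c \<in> C \<Longrightarrow> d \<in> C \<Longrightarrow> c \<otimes> d = d \<otimes> c"
  shows "\<exists>m. mean G m \<and>
    (\<forall>c\<in>C. \<forall>\<phi>. bounded (\<phi> ` carrier G) \<longrightarrow> m (\<lambda>h. \<phi> (c \<otimes> h)) = m \<phi>)"
proof -
  have "{m. mean G m} \<inter> (\<Inter>i\<in>C \<times> UNIV. {m. almost_invariant m (fst i) (snd i)}) \<noteq> {}"
  proof (rule compact_imp_fip_image[OF compact_mean closed_almost_invariant])
    fix I assume "finite I" "I \<subseteq> C \<times> (UNIV :: nat set)"
    then show "{m. mean G m} \<inter> (\<Inter>i\<in>I. {m. almost_invariant m (fst i) (snd i)}) \<noteq> {}"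
      using almost_invariant_exists[OF _ _ assms, of I] by fastforce
  qed
  then obtain m where m: "mean G m" and inv: "\<And>c N. c \<in> C \<Longrightarrow> almost_invariant m c N"
    by fastforce
  have "m (\<lambda>h. \<phi> (c \<otimes> h)) = m \<phi>" if "c \<in> C" and bd: "bounded (\<phi> ` carrier G)" for c \<phi>
  proof -
    obtain K where "\<forall>h\<in>carrier G. norm (\<phi> h) \<le> K" using bd by (auto simp: bounded_iff)
    then have *: "real (Suc N) * norm (m (\<lambda>h. \<phi> (c \<otimes> h)) - m \<phi>) \<le> 2 * K" for N
      using inv[OF \<open>c \<in> C\<close>, of N] unfolding almost_invariant_def by blast
    have "norm (m (\<lambda>h. \<phi> (c \<otimes> h)) - m \<phi>) \<le> 0"
    proof (rule ccontr)
      assume "\<not> norm (m (\<lambda>h. \<phi> (c \<otimes> h)) - m \<phi>) \<le> 0"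
      then obtain N where "2 * K < real N * norm (m (\<lambda>h. \<phi> (c \<otimes> h)) - m \<phi>)"
        by (metis not_le reals_Archimedean3)
      also have "\<dots> \<le> real (Suc N) * norm (m (\<lambda>h. \<phi> (c \<otimes> h)) - m \<phi>)"
        by (intro mult_right_mono) auto
      finally show False using *[of N] by simp
    qed
    then show ?thesis by simp
  qed
  then show ?thesis using m by blast
qed

section \<open>Transport of means along conjugacy classes\<close>

lemma inv_conj_cancel:
  assumes "g \<in> carrier G" "x \<in> carrier G"
  shows "inv g \<otimes> (g \<otimes> x \<otimes> inv g) \<otimes> g = x"
  using assms by (simp add: m_assoc) (simp add: m_assoc[symmetric])

lemma conj_eq_one_iff:
  assumes "g \<in> carrier G" "x \<in> carrier G"
  shows "g \<otimes> x \<otimes> inv g = \<one> \<longleftrightarrow> x = \<one>"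
  using inv_conj_cancel[OF assms] assms by auto

text \<open>Two elements conjugating r to the same y differ by an element of the centralizer of r.
  This makes transported means independent of the conjugator.\<close>

lemma intertwiner_quotient_commutes:
  assumes [simp]: "a \<in> carrier G" "b \<in> carrier G" "y \<in> carrier G" "r \<in> carrier G"
    and "y \<otimes> a = a \<otimes> r" "y \<otimes> b = b \<otimes> r"
  shows "(inv a \<otimes> b) \<otimes> r = r \<otimes> (inv a \<otimes> b)"
proof -
  have "a \<otimes> (inv a \<otimes> b \<otimes> r) = y \<otimes> b"
    using assms(6) by (simp add: m_assoc[symmetric])
  also have "\<dots> = (y \<otimes> a) \<otimes> (inv a \<otimes> b)"
    by (simp add: m_assoc) (simp add: m_assoc[symmetric])
  also have "\<dots> = a \<otimes> (r \<otimes> (inv a \<otimes> b))"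
    using assms(5) by (simp add: m_assoc)
  finally show ?thesis by simp
qed

text \<open>Pick a representative in each nontrivial conjugacy class, a mean for it invariant under
  its centralizer, and push this mean forward by a conjugator \<open>k x\<close> to each member x.
  Commutative transitivity makes the centralizer abelian, so that such a mean exists; its invariance
  absorbs the arbitrary choice of conjugators.\<close>

lemma equivariant_means_exist:
  assumes ct: "comm_transitive G"
  shows "\<exists>m. \<forall>x\<in>carrier G - {\<one>}. mean G (m x) \<and>
    (\<forall>g\<in>carrier G. \<forall>\<phi>. bounded (\<phi> ` carrier G) \<longrightarrow>
      m (g \<otimes> x \<otimes> inv g) \<phi> = m x (\<lambda>h. \<phi> (g \<otimes> h)))"
proof -
  define C where "C z = {c \<in> carrier G. c \<otimes> z = z \<otimes> c}" for z
  have "\<exists>m. mean G m \<and> (\<forall>c\<in>C z. \<forall>\<phi>. bounded (\<phi> ` carrier G) \<longrightarrow> m (\<lambda>h. \<phi> (c \<otimes> h)) = m \<phi>)"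
    if "z \<in> carrier G - {\<one>}" for z
  proof (rule invariant_mean_exists)
    show "C z \<subseteq> carrier G" by (auto simp: C_def)
    fix c d assume "c \<in> C z" "d \<in> C z"
    then show "c \<otimes> d = d \<otimes> c"
      using ct[unfolded comm_transitive_def, rule_format, OF that, of c d] unfolding C_def by blast
  qed
  then obtain \<mu> where \<mu>: "\<And>z. z \<in> carrier G - {\<one>} \<Longrightarrow> mean G (\<mu> z)"
    and \<mu>inv: "\<And>z c \<phi>. z \<in> carrier G - {\<one>} \<Longrightarrow> c \<in> C z \<Longrightarrow> bounded (\<phi> ` carrier G) \<Longrightarrow>
         \<mu> z (\<lambda>h. \<phi> (c \<otimes> h)) = \<mu> z \<phi>"
    by metis
  define cl where "cl x = (\<lambda>g. g \<otimes> x \<otimes> inv g) ` carrier G" for x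
  \<comment> \<open>The choice depends on x only through the set \<open>cl x\<close>, so conjugate
    elements receive the same representative.\<close>
  define r where "r x = (SOME z. z \<in> cl x)" for x
  define k where "k x = (SOME k. k \<in> carrier G \<and> x = k \<otimes> r x \<otimes> inv k)" for x
  define m where "m x \<phi> = \<mu> (r x) (\<lambda>h. \<phi> (k x \<otimes> h))" for x \<phi>
  have cl_conj: "cl (g \<otimes> x \<otimes> inv g) = cl x" if "g \<in> carrier G" "x \<in> carrier G" for g x
  proof -
    have "cl (g \<otimes> x \<otimes> inv g) = (\<lambda>h. h \<otimes> x \<otimes> inv h) ` (\<lambda>h. h \<otimes> g) ` carrier G"
      unfolding cl_def image_image
      by (rule image_cong) (use that in \<open>auto simp: inv_mult_group m_assoc\<close>)
    moreover have "(\<lambda>h. h \<otimes> g) ` carrier G = carrier G"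
    proof
      show "carrier G \<subseteq> (\<lambda>h. h \<otimes> g) ` carrier G"
      proof
        fix h assume "h \<in> carrier G"
        then have "h = (h \<otimes> inv g) \<otimes> g" "h \<otimes> inv g \<in> carrier G"
          using that by (simp_all add: m_assoc)
        then show "h \<in> (\<lambda>h. h \<otimes> g) ` carrier G" by blast
      qed
    qed (use that in auto)
    ultimately show ?thesis by (simp add: cl_def)
  qed
  have r: "r x \<in> carrier G - {\<one>} \<and> (\<exists>g\<in>carrier G. x = g \<otimes> r x \<otimes> inv g)"
    if x: "x \<in> carrier G - {\<one>}" for x
  proof -
    have "r x \<in> cl x" unfolding r_def
      by (rule someI[of _ "\<one> \<otimes> x \<otimes> inv \<one>"]) (use x in \<open>auto simp: cl_def intro!: image_eqI[of _ _ \<one>]\<close>)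
    then obtain g where g: "g \<in> carrier G" "r x = g \<otimes> x \<otimes> inv g" by (auto simp: cl_def)
    then have "inv g \<otimes> r x \<otimes> inv (inv g) = x" using x inv_conj_cancel by simp
    moreover have "r x \<noteq> \<one>" using g x conj_eq_one_iff by simp
    moreover have "inv g \<in> carrier G" "r x \<in> carrier G" using g x by auto
    ultimately show ?thesis by (metis Diff_iff singletonD)
  qed
  have k: "k x \<in> carrier G" "x = k x \<otimes> r x \<otimes> inv (k x)" if "x \<in> carrier G - {\<one>}" for x
    using someI_ex[of "\<lambda>k. k \<in> carrier G \<and> x = k \<otimes> r x \<otimes> inv k"] r[OF that]
    unfolding k_def by blast+
  have "m (g \<otimes> x \<otimes> inv g) \<phi> = m x (\<lambda>h. \<phi> (g \<otimes> h))"
    if x: "x \<in> carrier G - {\<one>}" and g: "g \<in> carrier G" and bd: "bounded (\<phi> ` carrier G)" for x g \<phi>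
  proof -
    let ?y = "g \<otimes> x \<otimes> inv g"
    have y: "?y \<in> carrier G - {\<one>}" using conj_eq_one_iff g x by auto
    have ry: "r ?y = r x" unfolding r_def using cl_conj g x by simp
    note [simp] = k(1)[OF x] k(1)[OF y]
    have rx: "r x \<in> carrier G" "r x \<in> carrier G - {\<one>}" using r[OF x] by auto
    \<comment> \<open>Both \<open>g \<otimes> k x\<close> and \<open>k ?y\<close> conjugate
      \<open>r x\<close> to \<open>?y\<close>, so their quotient centralizes \<open>r x\<close> and
      is invisible to \<open>\<mu> (r x)\<close>.\<close>
    let ?c = "inv (g \<otimes> k x) \<otimes> k ?y"
    have e: "z \<otimes> k z = k z \<otimes> r z" if "z \<in> carrier G - {\<one>}" for z
    proof -
      have "z \<otimes> k z = (k z \<otimes> r z \<otimes> inv (k z)) \<otimes> k z" using k(2)[OF that] by simp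
      then show ?thesis using k(1)[OF that] r[OF that] by (simp add: m_assoc)
    qed
    have "?y \<otimes> (g \<otimes> k x) = g \<otimes> (x \<otimes> k x)"
      using g x by (simp add: m_assoc) (simp add: m_assoc[symmetric])
    then have "?y \<otimes> (g \<otimes> k x) = (g \<otimes> k x) \<otimes> r x"
      using e[OF x] g rx by (simp add: m_assoc)
    moreover have "?y \<otimes> k ?y = k ?y \<otimes> r x" using e[OF y] ry by simp
    ultimately have c: "?c \<in> C (r x)"
      using intertwiner_quotient_commutes[of "g \<otimes> k x" "k ?y" ?y "r x"] g rx y
      by (simp add: C_def)
    let ?\<psi> = "\<lambda>h. \<phi> (g \<otimes> k x \<otimes> h)"
    have "m ?y \<phi> = \<mu> (r x) (\<lambda>h. ?\<psi> (?c \<otimes> h))"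
      unfolding m_def ry
    proof (rule mean_cong[OF \<mu>[OF rx(2)]])
      fix h assume "h \<in> carrier G"
      then show "\<phi> (k ?y \<otimes> h) = \<phi> (g \<otimes> k x \<otimes> (?c \<otimes> h))"
        using g by (simp add: m_assoc[symmetric])
    qed
    also have "\<dots> = \<mu> (r x) ?\<psi>"
      by (rule \<mu>inv[OF rx(2) c]) (use bounded_translate[OF bd] g in simp)
    also have "\<dots> = m x (\<lambda>h. \<phi> (g \<otimes> h))"
      unfolding m_def by (rule mean_cong[OF \<mu>[OF rx(2)]]) (simp add: g m_assoc)
    finally show ?thesis .
  qed
  moreover have "mean G (m x)" if "x \<in> carrier G - {\<one>}" for x
    unfolding m_def using mean_translate[OF \<mu> k(1)[OF that]] r[OF that] by blast
  ultimately show ?thesis by blast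
qed

end

section \<open>Multilinear extension from group elements\<close>

text \<open>Iterated sums let every proof follow the list recursion. As \<open>infsum\<close> is 0
  on non-summable families, the linearity and exchange laws below carry a uniform bound on
  f.\<close>

fun ext :: "('g, 'b) monoid_scheme \<Rightarrow> ('g list \<Rightarrow> complex) \<Rightarrow> ('g \<Rightarrow> complex) list \<Rightarrow> complex" where
  "ext G f [] = f []"
| "ext G f (a # as) = (\<Sum>\<^sub>\<infinity>g\<in>carrier G. a g * ext G (\<lambda>gs. f (g # gs)) as)"

definition bdd_on_lists :: "('g, 'b) monoid_scheme \<Rightarrow> nat \<Rightarrow> ('g list \<Rightarrow> complex) \<Rightarrow> real \<Rightarrow> bool" where
  "bdd_on_lists G n f K \<longleftrightarrow> 0 \<le> K \<and>
     (\<forall>gs. set gs \<subseteq> carrier G \<longrightarrow> length gs = n \<longrightarrow> norm (f gs) \<le> K)"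

lemma bdd_on_lists_Cons:
  "bdd_on_lists G (Suc n) f K \<Longrightarrow> g \<in> carrier G \<Longrightarrow> bdd_on_lists G n (\<lambda>gs. f (g # gs)) K"
  unfolding bdd_on_lists_def by auto

section \<open>Absolute summability against bounded functions\<close>

lemma l1D: "a \<in> l1 G \<Longrightarrow> (\<lambda>x. norm (a x)) summable_on carrier G"
  by (simp add: l1_def)

lemma l1norm_nonneg: "0 \<le> l1norm G a"
  unfolding l1norm_def by (rule infsum_nonneg) simp

lemma prod_list_l1norm_nonneg: "0 \<le> prod_list (map (l1norm G) as)"
  by (induction as) (simp_all add: l1norm_nonneg)

lemma l1_mult_bounded:
  assumes "a \<in> l1 G" "\<And>g. g \<in> carrier G \<Longrightarrow> norm (w g) \<le> M"
  shows "(\<lambda>g. norm (a g * w g)) summable_on carrier G"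
    and "norm (\<Sum>\<^sub>\<infinity>g\<in>carrier G. a g * w g) \<le> l1norm G a * M"
proof -
  have s: "(\<lambda>g. norm (a g) * M) summable_on carrier G"
    by (rule summable_on_cmult_left[OF l1D[OF assms(1)]])
  have le: "norm (a g * w g) \<le> norm (a g) * M" if "g \<in> carrier G" for g
    using assms(2)[OF that] by (simp add: norm_mult mult_left_mono)
  show *: "(\<lambda>g. norm (a g * w g)) summable_on carrier G"
    by (rule Infinite_Sum.abs_summable_on_comparison_test'[OF s le])
  have "norm (\<Sum>\<^sub>\<infinity>g\<in>carrier G. a g * w g) \<le> (\<Sum>\<^sub>\<infinity>g\<in>carrier G. norm (a g * w g))"
    by (rule norm_infsum_bound[OF *])
  also have "\<dots> \<le> (\<Sum>\<^sub>\<infinity>g\<in>carrier G. norm (a g) * M)"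
    by (rule infsum_mono[OF * s le])
  also have "\<dots> = l1norm G a * M"
    unfolding l1norm_def by (rule infsum_cmult_left) (use assms(1) l1D in blast)
  finally show "norm (\<Sum>\<^sub>\<infinity>g\<in>carrier G. a g * w g) \<le> l1norm G a * M" .
qed

text \<open>This is the Fubini hypothesis: inner absolute sums are bounded uniformly by M, and the
  outer weight a is summable.\<close>

lemma l1_double_summable:
  assumes "a \<in> l1 G"
    and "\<And>g. g \<in> carrier G \<Longrightarrow> (\<lambda>h. norm (w g h)) summable_on carrier G"
    and "\<And>g. g \<in> carrier G \<Longrightarrow> (\<Sum>\<^sub>\<infinity>h\<in>carrier G. norm (w g h)) \<le> M"
  shows "(\<lambda>(g, h). a g * w g h) summable_on carrier G \<times> carrier G"
proof (rule Infinite_Sum.abs_summable_summable, subst Infinite_Sum.abs_summable_on_Sigma_iff, intro conjI ballI)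
  fix g assume g: "g \<in> carrier G"
  show "(\<lambda>h. norm (case (g, h) of (g, h) \<Rightarrow> a g * w g h)) summable_on carrier G"
    using summable_on_cmult_right[OF assms(2)[OF g], of "norm (a g)"] by (simp add: norm_mult)
next
  have "(\<Sum>\<^sub>\<infinity>h\<in>carrier G. norm (a g * w g h)) = norm (a g) * (\<Sum>\<^sub>\<infinity>h\<in>carrier G. norm (w g h))" for g
    unfolding norm_mult by (rule infsum_cmult_right')
  moreover have "(\<lambda>g. norm (a g * of_real (\<Sum>\<^sub>\<infinity>h\<in>carrier G. norm (w g h)))) summable_on carrier G"
    by (rule l1_mult_bounded[OF assms(1), where M = M])
      (use assms(3) in \<open>simp add: infsum_nonneg\<close>)
  ultimately show "(\<lambda>g. norm (\<Sum>\<^sub>\<infinity>h\<in>carrier G. norm (case (g, h) of (g, h) \<Rightarrow> a g * w g h)))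
      summable_on carrier G"
    by (simp add: norm_mult infsum_nonneg)
qed

lemma l1_sum_swap:
  assumes "a \<in> l1 G" "b \<in> l1 G"
    and "\<And>g h. g \<in> carrier G \<Longrightarrow> h \<in> carrier G \<Longrightarrow> norm (F g h) \<le> K"
  shows "(\<Sum>\<^sub>\<infinity>g\<in>carrier G. a g * (\<Sum>\<^sub>\<infinity>h\<in>carrier G. b h * F g h))
       = (\<Sum>\<^sub>\<infinity>h\<in>carrier G. b h * (\<Sum>\<^sub>\<infinity>g\<in>carrier G. a g * F g h))"
proof -
  have "(\<lambda>(g, h). a g * (b h * F g h)) summable_on carrier G \<times> carrier G"
  proof (rule l1_double_summable[OF assms(1)])
    fix g assume g: "g \<in> carrier G"
    show "(\<lambda>h. norm (b h * F g h)) summable_on carrier G"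
      by (rule l1_mult_bounded[OF assms(2) assms(3)[OF g]])
    have "(\<Sum>\<^sub>\<infinity>h\<in>carrier G. norm (b h * F g h)) \<le> (\<Sum>\<^sub>\<infinity>h\<in>carrier G. norm (b h) * K)"
      by (rule infsum_mono[OF _ summable_on_cmult_left[OF l1D[OF assms(2)]]],
          rule l1_mult_bounded[OF assms(2) assms(3)[OF g]])
        (use assms(3)[OF g] in \<open>auto simp: norm_mult intro!: mult_left_mono\<close>)
    then show "(\<Sum>\<^sub>\<infinity>h\<in>carrier G. norm (b h * F g h)) \<le> (\<Sum>\<^sub>\<infinity>h\<in>carrier G. norm (b h) * K)" .
  qed
  from infsum_swap_banach[OF this] show ?thesis
    by (simp add: infsum_cmult_right'[symmetric] mult.left_commute)
qed

section \<open>Linearity, continuity and reordering of the extension\<close>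

lemma ext_cong:
  assumes "\<And>gs. set gs \<subseteq> carrier G \<Longrightarrow> length gs = length as \<Longrightarrow> f gs = f' gs"
  shows "ext G f as = ext G f' as"
  using assms
proof (induction as arbitrary: f f')
  case (Cons a as)
  have "ext G (\<lambda>gs. f (g # gs)) as = ext G (\<lambda>gs. f' (g # gs)) as" if "g \<in> carrier G" for g
    using that by (intro Cons.IH Cons.prems) auto
  then show ?case by (simp cong: infsum_cong)
qed simp

lemma ext_append: "ext G f (us @ vs) = ext G (\<lambda>gs. ext G (\<lambda>hs. f (gs @ hs)) vs) us"
  by (induction us arbitrary: f) simp_all

lemma ext_bound:
  assumes "set as \<subseteq> l1 G" "bdd_on_lists G (length as) f K"
  shows "norm (ext G f as) \<le> prod_list (map (l1norm G) as) * K"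
  using assms
proof (induction as arbitrary: f)
  case Nil
  then show ?case by (simp add: bdd_on_lists_def)
next
  case (Cons a as)
  have "norm (ext G (\<lambda>gs. f (g # gs)) as) \<le> prod_list (map (l1norm G) as) * K"
    if "g \<in> carrier G" for g
    using Cons.prems that by (intro Cons.IH bdd_on_lists_Cons) auto
  then show ?case using l1_mult_bounded(2)[of a G] Cons.prems(1) by (simp add: mult.assoc)
qed

lemma ext_Cons_summable:
  assumes "set (a # as) \<subseteq> l1 G" "bdd_on_lists G (Suc (length as)) f K"
  shows "(\<lambda>g. a g * ext G (\<lambda>gs. f (g # gs)) as) summable_on carrier G"
  by (rule Infinite_Sum.abs_summable_summable, rule l1_mult_bounded(1))
    (use assms ext_bound[OF _ bdd_on_lists_Cons[OF assms(2)]] in auto)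

lemma ext_lin:
  assumes "set as \<subseteq> l1 G" "bdd_on_lists G (length as) f K" "bdd_on_lists G (length as) f' K'"
  shows "ext G (\<lambda>gs. c * f gs + f' gs) as = c * ext G f as + ext G f' as"
  using assms
proof (induction as arbitrary: f f')
  case (Cons a as)
  have "ext G (\<lambda>gs. c * f (g # gs) + f' (g # gs)) as
      = c * ext G (\<lambda>gs. f (g # gs)) as + ext G (\<lambda>gs. f' (g # gs)) as" if "g \<in> carrier G" for g
    using Cons.prems that by (intro Cons.IH bdd_on_lists_Cons) auto
  then have "ext G (\<lambda>gs. c * f gs + f' gs) (a # as)
     = (\<Sum>\<^sub>\<infinity>g\<in>carrier G. c * (a g * ext G (\<lambda>gs. f (g # gs)) as) + a g * ext G (\<lambda>gs. f' (g # gs)) as)"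
    by (simp add: algebra_simps cong: infsum_cong)
  also have "\<dots> = c * ext G f (a # as) + ext G f' (a # as)"
    using Cons.prems
    by (subst infsum_add) (auto simp: infsum_cmult_right' intro!: summable_on_cmult_right ext_Cons_summable)
  finally show ?case .
qed simp

lemma bdd_on_lists_lin:
  assumes "bdd_on_lists G n f K" "bdd_on_lists G n f' K'"
  shows "bdd_on_lists G n (\<lambda>gs. c * f gs + f' gs) (norm c * K + K')"
  using assms unfolding bdd_on_lists_def
  by (auto simp: norm_mult intro!: norm_triangle_le add_mono mult_left_mono)

text \<open>The existential bound feeds \<open>ext_lin\<close> in the induction step and is used
  again when one more term is added to the sum.\<close>

lemma ext_sum:
  assumes "set as \<subseteq> l1 G" "finite I" "\<And>i. i \<in> I \<Longrightarrow> bdd_on_lists G (length as) (f i) K"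
  shows "ext G (\<lambda>gs. \<Sum>i\<in>I. c i * f i gs) as = (\<Sum>i\<in>I. c i * ext G (f i) as)
    \<and> (\<exists>K'. bdd_on_lists G (length as) (\<lambda>gs. \<Sum>i\<in>I. c i * f i gs) K')"
  using assms(2,3)
proof (induction I)
  case empty
  have z: "bdd_on_lists G (length as) (\<lambda>gs. 0) 0" by (simp add: bdd_on_lists_def)
  then show ?case using ext_bound[OF assms(1) z] by auto
next
  case (insert i I)
  then obtain K' where K': "bdd_on_lists G (length as) (\<lambda>gs. \<Sum>i\<in>I. c i * f i gs) K'" by auto
  show ?case
    using insert ext_lin[OF assms(1) insert.prems K', of i "c i"]
      bdd_on_lists_lin[OF insert.prems K', of i "c i"]
    by auto
qed

lemma ext_slot_lin:
  assumes "set us \<subseteq> l1 G" "a \<in> l1 G" "b \<in> l1 G" "set vs \<subseteq> l1 G"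
    and "bdd_on_lists G (length us + Suc (length vs)) f K"
  shows "ext G f (us @ (\<lambda>g. c * a g + b g) # vs) = c * ext G f (us @ a # vs) + ext G f (us @ b # vs)"
  using assms
proof (induction us arbitrary: f)
  case Nil
  have "ext G f ((\<lambda>g. c * a g + b g) # vs)
     = (\<Sum>\<^sub>\<infinity>g\<in>carrier G. c * (a g * ext G (\<lambda>gs. f (g # gs)) vs) + b g * ext G (\<lambda>gs. f (g # gs)) vs)"
    by (simp add: algebra_simps)
  also have "\<dots> = c * ext G f (a # vs) + ext G f (b # vs)"
    using Nil
    by (subst infsum_add) (auto simp: infsum_cmult_right' intro!: summable_on_cmult_right ext_Cons_summable)
  finally show ?case by simp
next
  case (Cons u us)
  have "ext G (\<lambda>gs. f (g # gs)) (us @ (\<lambda>g. c * a g + b g) # vs)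
      = c * ext G (\<lambda>gs. f (g # gs)) (us @ a # vs) + ext G (\<lambda>gs. f (g # gs)) (us @ b # vs)"
    if "g \<in> carrier G" for g
    using Cons.prems that by (intro Cons.IH bdd_on_lists_Cons) auto
  then have "ext G f ((u # us) @ (\<lambda>g. c * a g + b g) # vs)
     = (\<Sum>\<^sub>\<infinity>g\<in>carrier G. c * (u g * ext G (\<lambda>gs. f (g # gs)) (us @ a # vs))
          + u g * ext G (\<lambda>gs. f (g # gs)) (us @ b # vs))"
    by (simp add: algebra_simps cong: infsum_cong)
  also have "\<dots> = c * ext G f (u # us @ a # vs) + ext G f (u # us @ b # vs)"
    using Cons.prems
    by (subst infsum_add) (auto simp: infsum_cmult_right' intro!: summable_on_cmult_right ext_Cons_summable)
  finally show ?case by simp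
qed

text \<open>Fubini, applied once per slot, moves an outside summation through all the iterated
  sums.\<close>

lemma ext_exchange:
  assumes "set us \<subseteq> l1 G" "a \<in> l1 G" "\<And>g. g \<in> carrier G \<Longrightarrow> bdd_on_lists G (length us) (F g) K"
  shows "ext G (\<lambda>gs. \<Sum>\<^sub>\<infinity>g\<in>carrier G. a g * F g gs) us = (\<Sum>\<^sub>\<infinity>g\<in>carrier G. a g * ext G (F g) us)"
  using assms
proof (induction us arbitrary: F)
  case (Cons u us)
  have 1: "ext G (\<lambda>gs. \<Sum>\<^sub>\<infinity>g\<in>carrier G. a g * F g (h # gs)) us
      = (\<Sum>\<^sub>\<infinity>g\<in>carrier G. a g * ext G (\<lambda>gs. F g (h # gs)) us)" if "h \<in> carrier G" for h
    using Cons.prems that by (intro Cons.IH bdd_on_lists_Cons) auto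
  have 2: "norm (ext G (\<lambda>gs. F g (h # gs)) us) \<le> prod_list (map (l1norm G) us) * K"
    if "h \<in> carrier G" "g \<in> carrier G" for h g
    using Cons.prems that by (intro ext_bound bdd_on_lists_Cons) auto
  have "ext G (\<lambda>gs. \<Sum>\<^sub>\<infinity>g\<in>carrier G. a g * F g gs) (u # us)
      = (\<Sum>\<^sub>\<infinity>h\<in>carrier G. u h * (\<Sum>\<^sub>\<infinity>g\<in>carrier G. a g * ext G (\<lambda>gs. F g (h # gs)) us))"
    using 1 by (simp cong: infsum_cong)
  also have "\<dots> = (\<Sum>\<^sub>\<infinity>g\<in>carrier G. a g * (\<Sum>\<^sub>\<infinity>h\<in>carrier G. u h * ext G (\<lambda>gs. F g (h # gs)) us))"
    using Cons.prems by (intro l1_sum_swap[OF _ _ 2]) auto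
  finally show ?case by simp
qed simp

text \<open>Cyclic rotation of the group elements becomes cyclic rotation of the \<ell>^1 arguments:
  the outermost sum is moved to the innermost place.\<close>

lemma ext_rotate:
  assumes "set us \<subseteq> l1 G" "a \<in> l1 G" "bdd_on_lists G (Suc (length us)) f K"
  shows "ext G (\<lambda>gs. f (tl gs @ [hd gs])) (a # us) = ext G f (us @ [a])"
proof -
  have "ext G f (us @ [a]) = ext G (\<lambda>gs. \<Sum>\<^sub>\<infinity>g\<in>carrier G. a g * f (gs @ [g])) us"
    by (simp add: ext_append)
  also have "\<dots> = (\<Sum>\<^sub>\<infinity>g\<in>carrier G. a g * ext G (\<lambda>gs. f (gs @ [g])) us)"
    using assms by (intro ext_exchange) (auto simp: bdd_on_lists_def)
  finally show ?thesis by simp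
qed

context group
begin

section \<open>Convolution as contraction of adjacent entries\<close>

lemma sum_conv:
  assumes "a \<in> l1 G" "b \<in> l1 G" "\<And>g. g \<in> carrier G \<Longrightarrow> norm (w g) \<le> K"
  shows "(\<Sum>\<^sub>\<infinity>x\<in>carrier G. conv G a b x * w x)
       = (\<Sum>\<^sub>\<infinity>g\<in>carrier G. a g * (\<Sum>\<^sub>\<infinity>h\<in>carrier G. b h * w (g \<otimes> h)))"
proof -
  have bij: "bij_betw (\<lambda>h. g \<otimes> h) (carrier G) (carrier G)" if "g \<in> carrier G" for g
    using that inj_on_cmult surj_const_mult by (simp add: bij_betw_def)
  have shift: "b (inv g \<otimes> (g \<otimes> h)) = b h" if "g \<in> carrier G" "h \<in> carrier G" for g h
    using that by (simp add: m_assoc[symmetric])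
  let ?w = "\<lambda>g x. b (inv g \<otimes> x) * w x"
  have 1: "(\<lambda>(g, x). a g * ?w g x) summable_on carrier G \<times> carrier G"
  proof (rule l1_double_summable[OF assms(1)])
    fix g assume g: "g \<in> carrier G"
    have *: "(\<lambda>h. norm (b h * w (g \<otimes> h))) summable_on carrier G"
      by (rule l1_mult_bounded(1)[OF assms(2), where M = K]) (use assms(3) g in auto)
    then show "(\<lambda>x. norm (?w g x)) summable_on carrier G"
      using summable_on_reindex_bij_betw[OF bij[OF g], of "\<lambda>x. norm (?w g x)"] g
      by (simp add: shift cong: summable_on_cong)
    have "(\<Sum>\<^sub>\<infinity>x\<in>carrier G. norm (?w g x)) = (\<Sum>\<^sub>\<infinity>h\<in>carrier G. norm (b h * w (g \<otimes> h)))"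
      using infsum_reindex_bij_betw[OF bij[OF g], of "\<lambda>x. norm (?w g x)"] g
      by (simp add: shift cong: infsum_cong)
    also have "\<dots> \<le> (\<Sum>\<^sub>\<infinity>h\<in>carrier G. norm (b h) * K)"
      by (rule infsum_mono[OF * summable_on_cmult_left[OF l1D[OF assms(2)]]])
        (use assms(3) g in \<open>auto simp: norm_mult intro!: mult_left_mono\<close>)
    finally show "(\<Sum>\<^sub>\<infinity>x\<in>carrier G. norm (?w g x)) \<le> (\<Sum>\<^sub>\<infinity>h\<in>carrier G. norm (b h) * K)" .
  qed
  have "(\<Sum>\<^sub>\<infinity>x\<in>carrier G. conv G a b x * w x)
      = (\<Sum>\<^sub>\<infinity>x\<in>carrier G. \<Sum>\<^sub>\<infinity>g\<in>carrier G. a g * ?w g x)"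
    by (rule infsum_cong)
      (simp add: conv_def infsum_cmult_left'[symmetric] mult.assoc)
  also have "\<dots> = (\<Sum>\<^sub>\<infinity>g\<in>carrier G. \<Sum>\<^sub>\<infinity>x\<in>carrier G. a g * ?w g x)"
    by (rule infsum_swap_banach[OF 1, symmetric])
  also have "\<dots> = (\<Sum>\<^sub>\<infinity>g\<in>carrier G. a g * (\<Sum>\<^sub>\<infinity>h\<in>carrier G. b h * w (g \<otimes> h)))"
  proof (rule infsum_cong)
    fix g assume g: "g \<in> carrier G"
    show "(\<Sum>\<^sub>\<infinity>x\<in>carrier G. a g * ?w g x) = a g * (\<Sum>\<^sub>\<infinity>h\<in>carrier G. b h * w (g \<otimes> h))"
      using infsum_reindex_bij_betw[OF bij[OF g], of "?w g"] g
      by (simp add: shift infsum_cmult_right' cong: infsum_cong)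
  qed
  finally show ?thesis .
qed

text \<open>The inner Hochschild face, recursive so as to match the recursion of \<open>ext\<close>.
  Leaving too short lists unchanged lets membership in the carrier and invariance of the product
  hold for every index.\<close>

fun contract :: "nat \<Rightarrow> 'a list \<Rightarrow> 'a list" where
  "contract 0 (g # h # gs) = (g \<otimes> h) # gs"
| "contract (Suc i) (g # gs) = g # contract i gs"
| "contract _ gs = gs"

lemma contract_length: "Suc i < length gs \<Longrightarrow> length (contract i gs) = length gs - 1"
  by (induction i gs rule: contract.induct) auto

lemma contract_carrier: "set gs \<subseteq> carrier G \<Longrightarrow> set (contract i gs) \<subseteq> carrier G"
  by (induction i gs rule: contract.induct) auto

lemma contract_eq:
  "Suc i < length gs \<Longrightarrow> contract i gs = take i gs @ [gs ! i \<otimes> gs ! (i + 1)] @ drop (i + 2) gs"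
  by (induction i gs rule: contract.induct) auto

text \<open>The slots before index i are peeled off one by one; at index 0 the substitution x = gh
  in \<open>sum_conv\<close> turns the double sum into a single sum against the convolution.\<close>

lemma ext_contract:
  assumes "set as \<subseteq> l1 G" "Suc i < length as" "bdd_on_lists G (length as - 1) f K"
  shows "ext G (\<lambda>gs. f (contract i gs)) as
       = ext G f (take i as @ [conv G (as ! i) (as ! (i + 1))] @ drop (i + 2) as)"
  using assms
proof (induction i arbitrary: as f)
  case 0
  then obtain a b bs where as: "as = a # b # bs"
    by (metis One_nat_def length_0_conv length_Cons less_numeral_extra(3) less_one neq_Nil_conv not_less_zero)
  have "norm (ext G (\<lambda>gs. f (g # gs)) bs) \<le> prod_list (map (l1norm G) bs) * K"
    if "g \<in> carrier G" for g
    using 0 as that by (intro ext_bound bdd_on_lists_Cons) auto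
  then show ?case
    using sum_conv[of a b "\<lambda>g. ext G (\<lambda>gs. f (g # gs)) bs" "prod_list (map (l1norm G) bs) * K"] 0 as
    by simp
next
  case (Suc i)
  then obtain a bs where as: "as = a # bs" by (cases as) auto
  have len: "Suc (length bs - Suc 0) = length bs" using Suc.prems as by simp
  have "ext G (\<lambda>gs. f (g # contract i gs)) bs
       = ext G (\<lambda>gs. f (g # gs)) (take i bs @ [conv G (bs ! i) (bs ! (i + 1))] @ drop (i + 2) bs)"
    if "g \<in> carrier G" for g
    using Suc.prems as that
    by (intro Suc.IH bdd_on_lists_Cons) (auto simp: len)
  then show ?case using as by (simp cong: infsum_cong)
qed

end

section \<open>Cyclic cocycles\<close>

context group
begin

definition lprod :: "'a list \<Rightarrow> 'a" where
  "lprod gs = foldr (\<otimes>) gs \<one>"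

lemma lprod_simps [simp]: "lprod [] = \<one>" "lprod (g # gs) = g \<otimes> lprod gs"
  by (simp_all add: lprod_def)

lemma lprod_closed [simp]: "set gs \<subseteq> carrier G \<Longrightarrow> lprod gs \<in> carrier G"
  by (induction gs) simp_all

lemma lprod_append [simp]:
  "set gs \<subseteq> carrier G \<Longrightarrow> set hs \<subseteq> carrier G \<Longrightarrow> lprod (gs @ hs) = lprod gs \<otimes> lprod hs"
  by (induction gs) (simp_all add: m_assoc)

lemma lprod_contract: "set gs \<subseteq> carrier G \<Longrightarrow> lprod (contract i gs) = lprod gs"
  by (induction i gs rule: contract.induct) (simp_all add: m_assoc)

lemma contract_append: "Suc i < length gs \<Longrightarrow> contract i (gs @ hs) = contract i gs @ hs"
  by (induction i gs rule: contract.induct) auto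

lemma contract_last: "contract (length gs) (gs @ [g, h]) = gs @ [g \<otimes> h]"
  by (induction gs) auto

text \<open>The face coming from the left action (a.\<phi>)(x) = \<phi>(x*a): the first group
  element multiplies the last entry from the right.\<close>

definition rot :: "'a list \<Rightarrow> 'a list" where
  "rot gs = butlast (tl gs) @ [last gs \<otimes> hd gs]"

text \<open>A right inverse of \<open>rot\<close> for each h, since the added h^-1 and h cancel
  cyclically. The total product is conjugated by h^-1.\<close>

definition twist :: "'a \<Rightarrow> 'a list \<Rightarrow> 'a list" where
  "twist h gs = inv h # butlast gs @ [last gs \<otimes> h]"

text \<open>The dual of the Hochschild boundary on group tuples, with the coefficient entry written
  last. The final contraction, which meets that entry, is the face of the right action.\<close>

definition bdry :: "('a list \<Rightarrow> complex) \<Rightarrow> 'a list \<Rightarrow> complex" where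
  "bdry f gs = f (rot gs) + (\<Sum>i<length gs - 1. (-1) ^ (i + 1) * f (contract i gs))"

lemma rot_snoc [simp]: "rot (g # us @ [y]) = us @ [y \<otimes> g]"
  by (simp add: rot_def)

lemma twist_snoc [simp]: "twist h (us @ [y]) = inv h # us @ [y \<otimes> h]"
  by (simp add: twist_def)

lemma twist_closed:
  assumes "set gs \<subseteq> carrier G" "gs \<noteq> []" "h \<in> carrier G"
  shows "set (twist h gs) \<subseteq> carrier G"
  using assms by (cases gs rule: rev_cases) auto

lemma length_twist [simp]: "gs \<noteq> [] \<Longrightarrow> length (twist h gs) = Suc (length gs)"
  by (cases gs rule: rev_cases) auto

text \<open>The index shifts by one because of the h^-1 in front. Associativity is needed only when
  the contracted pair includes the last entry, the one carrying the factor h.\<close>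

lemma contract_twist:
  assumes "set gs \<subseteq> carrier G" "h \<in> carrier G" "Suc i < length gs"
  shows "contract (Suc i) (twist h gs) = twist h (contract i gs)"
proof -
  obtain us y where gs: "gs = us @ [y]" using assms by (cases gs rule: rev_cases) auto
  show ?thesis
  proof (cases "Suc i < length us")
    case True
    then have "contract i gs = contract i us @ [y]" by (simp add: gs contract_append)
    then show ?thesis using True by (simp add: gs contract_append)
  next
    case False
    then obtain vs g where us: "us = vs @ [g]" and i: "i = length vs"
      using assms gs by (cases us rule: rev_cases) auto
    have 1: "contract i (vs @ [g, w]) = vs @ [g \<otimes> w]" for w
      by (simp add: i contract_last)
    show ?thesis using assms 1 twist_snoc[of h vs "g \<otimes> y"] twist_snoc[of h "vs @ [g]" y]
      by (simp add: gs us m_assoc)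
  qed
qed

text \<open>Evaluate the cocycle identity on \<open>twist h gs\<close>. Its rotation is
  \<open>gs\<close> itself, free of h, while each remaining face is a twist of a face of
  \<open>gs\<close>. Applying the mean in h fixes the free term and turns the others into values of
  \<open>s\<close>. A mean does not increase the bound, so K is kept.\<close>

lemma coboundary_of_cyclic_cocycle:
  assumes ct: "comm_transitive G" and n: "n \<ge> 1"
    and bd: "bdd_on_lists G (n + 1) t K"
    and cocycle: "\<And>gs. set gs \<subseteq> carrier G \<Longrightarrow> length gs = n + 2 \<Longrightarrow> bdry t gs = 0"
    and vanish: "\<And>gs. set gs \<subseteq> carrier G \<Longrightarrow> length gs = n + 1 \<Longrightarrow> lprod gs = \<one> \<Longrightarrow> t gs = 0"
  shows "\<exists>s. bdd_on_lists G n s K \<and>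
    (\<forall>gs. set gs \<subseteq> carrier G \<longrightarrow> length gs = n + 1 \<longrightarrow> t gs = bdry s gs)"
proof -
  obtain m where m: "\<And>x. x \<in> carrier G \<Longrightarrow> x \<noteq> \<one> \<Longrightarrow> mean G (m x)"
    and equiv: "\<And>x g \<phi>. x \<in> carrier G \<Longrightarrow> x \<noteq> \<one> \<Longrightarrow> g \<in> carrier G \<Longrightarrow> bounded (\<phi> ` carrier G)
         \<Longrightarrow> m (g \<otimes> x \<otimes> inv g) \<phi> = m x (\<lambda>h. \<phi> (g \<otimes> h))"
    using equivariant_means_exist[OF ct] by (metis Diff_iff singletonD)
  \<comment> \<open>At total product 1 no mean has been chosen. The value 0 is consistent: all faces
    of such a tuple again have product 1, and t vanishes there by assumption.\<close>
  define s where "s gs = (if lprod gs = \<one> then 0 else m (lprod gs) (\<lambda>h. t (twist h gs)))" for gs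
  have tb: "norm (t (twist h gs)) \<le> K"
    if "h \<in> carrier G" "set gs \<subseteq> carrier G" "length gs = n" for gs h
  proof -
    have "gs \<noteq> []" using that n by auto
    then show ?thesis using bd twist_closed[of gs h] that unfolding bdd_on_lists_def by simp
  qed
  then have tbd: "bounded ((\<lambda>h. t (twist h gs)) ` carrier G)"
    if "set gs \<subseteq> carrier G" "length gs = n" for gs
    using that unfolding bounded_iff by blast
  have "bdd_on_lists G n s K"
    unfolding bdd_on_lists_def
  proof (intro conjI allI impI)
    show "0 \<le> K" using bd by (simp add: bdd_on_lists_def)
    fix gs assume "set gs \<subseteq> carrier G" "length gs = n"
    then show "norm (s gs) \<le> K"
      using mean_le[OF m] tb \<open>0 \<le> K\<close> unfolding s_def by simp
  qed
  moreover have "t gs = bdry s gs" if gs: "set gs \<subseteq> carrier G" "length gs = n + 1" for gs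
  proof -
    obtain g gs' where "gs = g # gs'" "gs' \<noteq> []" using gs n by (cases gs) fastforce+
    then obtain us y where gs_eq: "gs = g # us @ [y]" by (metis append_butlast_last_id)
    have [simp]: "g \<in> carrier G" "y \<in> carrier G" "set us \<subseteq> carrier G" and lus: "length us = n - 1"
      using gs gs_eq n by auto
    define x where "x = lprod gs"
    have x: "x \<in> carrier G" using gs by (simp add: x_def)
    have rot_x: "lprod (rot gs) = inv g \<otimes> x \<otimes> inv (inv g)"
      by (simp add: x_def gs_eq m_assoc) (simp add: m_assoc[symmetric])
    have con: "set (contract i gs) \<subseteq> carrier G" "lprod (contract i gs) = x" for i
      using gs contract_carrier lprod_contract by (auto simp: x_def)
    have clen: "length (contract i gs) = n" if "i < n" for i
      using gs that by (simp add: contract_length)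
    show ?thesis
    proof (cases "x = \<one>")
      case True
      then have "s (rot gs) = 0" "s (contract i gs) = 0" for i
        using rot_x con by (simp_all add: s_def)
      then show ?thesis using vanish[OF gs] True by (simp add: bdry_def x_def)
    next
      case False
      \<comment> \<open>In the contraction of h^-1 with g the front entry is h^-1 g, the inverse of
        g^-1 h; hence the translated twist parameter.\<close>
      let ?\<phi> = "\<lambda>h. t (twist (inv g \<otimes> h) (rot gs))"
      let ?\<psi> = "\<lambda>h. \<Sum>i<n. (-1) ^ (i + 1) * t (twist h (contract i gs))"
      have rgs: "set (rot gs) \<subseteq> carrier G" "length (rot gs) = n"
        using lus n by (simp_all add: gs_eq)
      have \<phi>: "bounded (?\<phi> ` carrier G)"
        using bounded_translate[OF tbd[OF rgs], of "inv g"] by simp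
      have \<psi>: "bounded (?\<psi> ` carrier G)"
          "m x ?\<psi> = (\<Sum>i<n. (-1) ^ (i + 1) * m x (\<lambda>h. t (twist h (contract i gs))))"
        using mean_sum[OF m[OF x False], of "{..<n}" "\<lambda>i h. t (twist h (contract i gs))" "\<lambda>i. (-1) ^ (i + 1)"]
          tbd con clen by simp_all
      have "t gs = 1 * ?\<phi> h + ?\<psi> h" if [simp]: "h \<in> carrier G" for h
      proof -
        have tw: "twist h gs = inv h # (g # us) @ [y \<otimes> h]"
          using twist_snoc[of h "g # us" y] by (simp add: gs_eq)
        have r: "rot (twist h gs) = gs"
          unfolding tw rot_snoc by (simp add: gs_eq m_assoc)
        have c0: "contract 0 (twist h gs) = twist (inv g \<otimes> h) (rot gs)"
          unfolding tw by (simp add: gs_eq inv_mult_group m_assoc) (simp add: m_assoc[symmetric])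
        have len: "length (twist h gs) - 1 = Suc n" using gs(2) by (cases gs) auto
        have "0 = bdry t (twist h gs)"
          using cocycle[OF twist_closed] gs by (cases gs) auto
        also have "\<dots> = t gs + ((\<Sum>i<Suc n. (-1) ^ (i + 1) * t (contract i (twist h gs))))"
          unfolding bdry_def len r ..
        \<comment> \<open>Index 0 enters with sign -1; renumbering the other indices from 0 reverses
          their signs.\<close>
        also have "\<dots> = t gs - ?\<phi> h - (\<Sum>i<n. (-1) ^ (i + 1) * t (contract (Suc i) (twist h gs)))"
          unfolding sum.lessThan_Suc_shift c0 by (simp add: sum_negf)
        also have "(\<Sum>i<n. (-1) ^ (i + 1) * t (contract (Suc i) (twist h gs))) = ?\<psi> h"
          using gs by (intro sum.cong) (simp_all add: contract_twist)
        finally show ?thesis by (simp add: algebra_simps)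
      qed
      then have "m x (\<lambda>h. 1 * ?\<phi> h + ?\<psi> h) = m x (\<lambda>_. t gs)"
        by (intro mean_cong[OF m[OF x False]]) simp
      then have "t gs = m x (\<lambda>h. 1 * ?\<phi> h + ?\<psi> h)"
        using mean_const[OF m[OF x False]] by simp
      also have "\<dots> = m x ?\<phi> + m x ?\<psi>"
        using mean_lin[OF m[OF x False] \<phi> \<psi>(1), of 1] by simp
      \<comment> \<open>The translation by g^-1 is exactly what equivariance converts into the mean
        at g^-1 x g, the total product of \<open>rot gs\<close>.\<close>
      also have "m x ?\<phi> = s (rot gs)"
        using equiv[OF x False, of "inv g", OF _ tbd[OF rgs]] False x rot_x
          conj_eq_one_iff[of "inv g" x] by (simp add: s_def)
      also have "m x ?\<psi> = (\<Sum>i<n. (-1) ^ (i + 1) * s (contract i gs))"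
        unfolding \<psi>(2) using False con by (intro sum.cong) (simp_all add: s_def)
      finally show ?thesis using gs by (simp add: bdry_def)
    qed
  qed
  ultimately show ?thesis by blast
qed

end

section \<open>Bounded functionals on \<ell>^1(G) and on I_0(G)\<close>

definition delta :: "'g \<Rightarrow> 'g \<Rightarrow> complex" where
  "delta g = (\<lambda>x. if x = g then 1 else 0)"

lemma infsum_delta:
  assumes "g \<in> A"
  shows "(\<Sum>\<^sub>\<infinity>x\<in>A. delta g x * w x) = w g"
proof -
  have "(\<Sum>\<^sub>\<infinity>x\<in>A. delta g x * w x) = (\<Sum>\<^sub>\<infinity>x\<in>{g}. w x)"
    by (rule infsum_cong_neutral) (use assms in \<open>auto simp: delta_def\<close>)
  then show ?thesis by simp
qed

lemma l1_delta [simp]: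
  assumes "g \<in> carrier G"
  shows "delta g \<in> l1 G" "l1norm G (delta g) = 1"
proof -
  have "(\<lambda>x. norm (delta g x)) summable_on carrier G \<longleftrightarrow> (\<lambda>x. 1 :: real) summable_on {g}"
    by (rule summable_on_cong_neutral) (use assms in \<open>auto simp: delta_def\<close>)
  then show "delta g \<in> l1 G" using assms by (auto simp: l1_def delta_def)
  have "l1norm G (delta g) = (\<Sum>\<^sub>\<infinity>x\<in>{g}. 1)"
    unfolding l1norm_def by (rule infsum_cong_neutral) (use assms in \<open>auto simp: delta_def\<close>)
  then show "l1norm G (delta g) = 1" by simp
qed

lemma
  assumes "a \<in> l1 G" "b \<in> l1 G"
  shows l1_lin: "(\<lambda>g. c * a g + b g) \<in> l1 G"
    and l1norm_lin: "l1norm G (\<lambda>g. c * a g + b g) \<le> norm c * l1norm G a + l1norm G b"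
    and sum_lin: "(\<Sum>\<^sub>\<infinity>g\<in>carrier G. c * a g + b g)
      = c * (\<Sum>\<^sub>\<infinity>g\<in>carrier G. a g) + (\<Sum>\<^sub>\<infinity>g\<in>carrier G. b g)"
proof -
  have s: "(\<lambda>g. norm c * norm (a g) + norm (b g)) summable_on carrier G"
    by (intro summable_on_add summable_on_cmult_right l1D assms)
  have le: "norm (c * a g + b g) \<le> norm c * norm (a g) + norm (b g)" for g
    by (metis norm_mult norm_triangle_ineq)
  have *: "(\<lambda>g. norm (c * a g + b g)) summable_on carrier G"
    by (rule Infinite_Sum.abs_summable_on_comparison_test'[OF s le])
  then show "(\<lambda>g. c * a g + b g) \<in> l1 G" using assms by (simp add: l1_def)
  have "l1norm G (\<lambda>g. c * a g + b g) \<le> (\<Sum>\<^sub>\<infinity>g\<in>carrier G. norm c * norm (a g) + norm (b g))"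
    unfolding l1norm_def by (rule infsum_mono[OF * s le])
  also have "\<dots> = norm c * l1norm G a + l1norm G b"
    unfolding l1norm_def
    by (subst infsum_add) (auto simp: infsum_cmult_right' intro!: summable_on_cmult_right l1D assms)
  finally show "l1norm G (\<lambda>g. c * a g + b g) \<le> norm c * l1norm G a + l1norm G b" .
  show "(\<Sum>\<^sub>\<infinity>g\<in>carrier G. c * a g + b g)
      = c * (\<Sum>\<^sub>\<infinity>g\<in>carrier G. a g) + (\<Sum>\<^sub>\<infinity>g\<in>carrier G. b g)"
    using infsum_add[OF summable_on_cmult_right[OF Infinite_Sum.abs_summable_summable[OF l1D]]
        Infinite_Sum.abs_summable_summable[OF l1D], OF assms, of c]
    by (simp add: infsum_cmult_right')
qed

lemma norm_sum_le_l1norm: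
  assumes "a \<in> l1 G"
  shows "norm (\<Sum>\<^sub>\<infinity>g\<in>carrier G. a g) \<le> l1norm G a"
  unfolding l1norm_def by (rule norm_infsum_bound[OF l1D[OF assms]])

text \<open>Finitely supported functions are dense: after removing a finite set F, the remaining
  part of a has norm equal to the tail of the series for \<open>l1norm G a\<close>, which tends to
  0.\<close>

lemma functional_expansion:
  assumes lin: "\<And>a b c. a \<in> l1 G \<Longrightarrow> b \<in> l1 G \<Longrightarrow> u (\<lambda>g. c * a g + b g) = c * u a + u b"
    and bd: "\<And>a. a \<in> l1 G \<Longrightarrow> norm (u a :: complex) \<le> K * l1norm G a"
    and a: "a \<in> l1 G"
  shows "u a = (\<Sum>\<^sub>\<infinity>g\<in>carrier G. a g * u (delta g))"
proof -
  define tail where "tail F = (\<lambda>g. if g \<in> F then 0 else a g)" for F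
  have tail_l1: "tail F \<in> l1 G" for F
  proof -
    have "(\<lambda>x. norm (tail F x)) summable_on carrier G"
      by (rule Infinite_Sum.abs_summable_on_comparison_test'[OF l1D[OF a]]) (simp add: tail_def)
    then show ?thesis using a by (simp add: l1_def tail_def)
  qed
  have split: "u a = (\<Sum>g\<in>F. a g * u (delta g)) + u (tail F)"
    if "finite F" "F \<subseteq> carrier G" for F
    using that
  proof (induction F)
    case empty
    then show ?case by (simp add: tail_def)
  next
    case (insert g F)
    have "tail F = (\<lambda>x. a g * delta g x + tail (insert g F) x)"
      using insert by (auto simp: tail_def delta_def)
    then have "u (tail F) = a g * u (delta g) + u (tail (insert g F))"
      using lin[OF _ tail_l1, of "delta g" "a g"] insert by simp
    then show ?case using insert by simp
  qed
  have tail_norm: "l1norm G (tail F) = l1norm G a - (\<Sum>g\<in>F. norm (a g))"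
    if "finite F" "F \<subseteq> carrier G" for F
  proof -
    have "l1norm G (tail F) = (\<Sum>\<^sub>\<infinity>g\<in>carrier G - F. norm (a g))"
      unfolding l1norm_def by (rule infsum_cong_neutral) (auto simp: tail_def)
    also have "\<dots> = l1norm G a - (\<Sum>\<^sub>\<infinity>g\<in>F. norm (a g))"
      unfolding l1norm_def by (rule infsum_Diff) (use that a l1D in auto)
    finally show ?thesis using that by simp
  qed
  have "((\<lambda>F. (\<Sum>g\<in>F. a g * u (delta g)) - u a) \<longlongrightarrow> 0) (finite_subsets_at_top (carrier G))"
  proof (rule Lim_null_comparison)
    show "\<forall>\<^sub>F F in finite_subsets_at_top (carrier G).
        norm ((\<Sum>g\<in>F. a g * u (delta g)) - u a) \<le> K * (l1norm G a - (\<Sum>g\<in>F. norm (a g)))"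
    proof (rule eventually_finite_subsets_at_top_weakI)
      fix F assume F: "finite F" "F \<subseteq> carrier G"
      have "(\<Sum>g\<in>F. a g * u (delta g)) - u a = - u (tail F)"
        using split[OF F] by simp
      then show "norm ((\<Sum>g\<in>F. a g * u (delta g)) - u a) \<le> K * (l1norm G a - (\<Sum>g\<in>F. norm (a g)))"
        using bd[OF tail_l1, of F] tail_norm[OF F] by simp
    qed
    have "((\<lambda>F. \<Sum>g\<in>F. norm (a g)) \<longlongrightarrow> l1norm G a) (finite_subsets_at_top (carrier G))"
      unfolding l1norm_def by (rule infsum_tendsto[OF l1D[OF a]])
    then have "((\<lambda>F. K * (l1norm G a - (\<Sum>g\<in>F. norm (a g)))) \<longlongrightarrow> K * (l1norm G a - l1norm G a))
        (finite_subsets_at_top (carrier G))"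
      by (intro tendsto_intros)
    then show "((\<lambda>F. K * (l1norm G a - (\<Sum>g\<in>F. norm (a g)))) \<longlongrightarrow> 0)
        (finite_subsets_at_top (carrier G))" by simp
  qed
  then have "((\<lambda>g. a g * u (delta g)) has_sum u a) (carrier G)"
    unfolding has_sum_def by (rule LIM_zero_cancel)
  then show ?thesis by (simp add: infsumI)
qed

lemma aug_ideal_l1: "x \<in> aug_ideal G \<Longrightarrow> x \<in> l1 G"
  by (simp add: aug_ideal_def)

text \<open>Compose u with the projection a -> a - \<epsilon>(a) e(z) of \<ell>^1(G) onto I_0(G),
  expand on the whole of \<ell>^1(G), and use that the projection fixes x.\<close>

lemma aug_functional_expansion:
  assumes lin: "\<And>a b c. a \<in> aug_ideal G \<Longrightarrow> b \<in> aug_ideal G \<Longrightarrow> u (\<lambda>g. c * a g + b g) = c * u a + u b"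
    and bd: "\<And>a. a \<in> aug_ideal G \<Longrightarrow> norm (u a :: complex) \<le> K * l1norm G a"
    and z: "z \<in> carrier G" and x: "x \<in> aug_ideal G"
  shows "u x = (\<Sum>\<^sub>\<infinity>y\<in>carrier G. x y * u (\<lambda>g. delta y g - delta z g))"
proof -
  define \<epsilon> where "\<epsilon> a = (\<Sum>\<^sub>\<infinity>g\<in>carrier G. a g)" for a :: "'a \<Rightarrow> complex"
  define pr where "pr a = (\<lambda>g. (- \<epsilon> a) * delta z g + a g)" for a
  have \<epsilon>_delta: "\<epsilon> (delta y) = 1" if "y \<in> carrier G" for y
    using infsum_delta[OF that, of "\<lambda>_. 1"] by (simp add: \<epsilon>_def)
  have \<epsilon>_lin: "\<epsilon> (\<lambda>g. c * a g + b g) = c * \<epsilon> a + \<epsilon> b" if "a \<in> l1 G" "b \<in> l1 G" for a b c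
    unfolding \<epsilon>_def by (rule sum_lin[OF that])
  have pr: "pr a \<in> aug_ideal G" if "a \<in> l1 G" for a
  proof -
    have "\<epsilon> (pr a) = 0"
      unfolding pr_def \<epsilon>_lin[OF l1_delta(1)[OF z] that] \<epsilon>_delta[OF z] by simp
    moreover have "pr a \<in> l1 G"
      unfolding pr_def by (rule l1_lin[OF l1_delta(1)[OF z] that])
    ultimately show ?thesis by (simp add: aug_ideal_def \<epsilon>_def)
  qed
  have "u (pr x) = (\<Sum>\<^sub>\<infinity>y\<in>carrier G. x y * u (pr (delta y)))"
  \<comment> \<open>The projection has norm at most 2. The absolute value is taken because the bound
    on u does not state that K is nonnegative.\<close>
  proof (rule functional_expansion[of G "\<lambda>a. u (pr a)" "\<bar>K\<bar> * 2"])
    fix a b c assume *: "a \<in> l1 G" "b \<in> l1 G"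
    have "pr (\<lambda>g. c * a g + b g) = (\<lambda>g. c * pr a g + pr b g)"
      using \<epsilon>_lin[OF *] by (simp add: pr_def algebra_simps)
    then show "u (pr (\<lambda>g. c * a g + b g)) = c * u (pr a) + u (pr b)"
      using lin pr * by simp
  next
    fix a assume a: "a \<in> l1 G"
    have "l1norm G (pr a) \<le> norm (- \<epsilon> a) * l1norm G (delta z) + l1norm G a"
      unfolding pr_def by (rule l1norm_lin[OF l1_delta(1)[OF z] a])
    also have "\<dots> \<le> 2 * l1norm G a"
      using norm_sum_le_l1norm[OF a] z by (simp add: \<epsilon>_def)
    finally have "l1norm G (pr a) \<le> 2 * l1norm G a" .
    moreover have "norm (u (pr a)) \<le> \<bar>K\<bar> * l1norm G (pr a)"
      by (rule order_trans[OF bd[OF pr[OF a]]]) (simp add: mult_right_mono l1norm_nonneg)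
    moreover have "\<bar>K\<bar> * l1norm G (pr a) \<le> \<bar>K\<bar> * (2 * l1norm G a)"
      by (rule mult_left_mono) (use calculation in simp_all)
    ultimately show "norm (u (pr a)) \<le> \<bar>K\<bar> * 2 * l1norm G a" by simp
  qed (rule aug_ideal_l1[OF x])
  moreover have "pr x = x" using x by (simp add: pr_def aug_ideal_def \<epsilon>_def)
  moreover have "pr (delta y) = (\<lambda>g. delta y g - delta z g)" if "y \<in> carrier G" for y
    using \<epsilon>_delta[OF that] by (simp add: pr_def)
  ultimately show ?thesis by (simp cong: infsum_cong)
qed

section \<open>Cochains and their values on basis vectors\<close>

lemma cochain_lin_slot:
  assumes "cochain G n T" "set us \<subseteq> l1 G" "set vs \<subseteq> l1 G" "Suc (length us + length vs) = n"
    "a \<in> l1 G" "b \<in> l1 G" "x \<in> aug_ideal G"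
  shows "T (us @ (\<lambda>g. c * a g + b g) # vs) x = c * T (us @ a # vs) x + T (us @ b # vs) x"
proof -
  have "set (us @ a # vs) \<subseteq> l1 G" "length (us @ a # vs) = n" "length us < n"
    using assms by auto
  then have "T ((us @ a # vs)[length us := (\<lambda>g. c * a g + b g)]) x
     = c * T ((us @ a # vs)[length us := a]) x + T ((us @ a # vs)[length us := b]) x"
    using assms unfolding cochain_def by blast
  then show ?thesis by simp
qed

lemma cochain_lin:
  assumes "cochain G n T" "set as \<subseteq> l1 G" "length as = n" "x \<in> aug_ideal G" "y \<in> aug_ideal G"
  shows "T as (\<lambda>g. c * x g + y g) = c * T as x + T as y"
  using assms unfolding cochain_def by blast

lemma cochain_bound:
  assumes "cochain G n T"
  obtains C where "C \<ge> 0" "\<And>as x. set as \<subseteq> l1 G \<Longrightarrow> length as = n \<Longrightarrow> x \<in> aug_ideal G \<Longrightarrow>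
    norm (T as x) \<le> C * prod_list (map (l1norm G) as) * l1norm G x"
proof -
  obtain C where C: "\<forall>as. set as \<subseteq> l1 G \<longrightarrow> length as = n \<longrightarrow> (\<forall>x\<in>aug_ideal G.
    norm (T as x) \<le> C * prod_list (map (l1norm G) as) * l1norm G x)"
    using assms unfolding cochain_def by (elim conjE exE)
  show thesis
  proof (rule that[of "\<bar>C\<bar>"])
    fix as x assume "set as \<subseteq> l1 G" "length as = n" "x \<in> aug_ideal G"
    then have "norm (T as x) \<le> C * prod_list (map (l1norm G) as) * l1norm G x"
      using C by blast
    also have "\<dots> \<le> \<bar>C\<bar> * prod_list (map (l1norm G) as) * l1norm G x"
      by (intro mult_right_mono l1norm_nonneg prod_list_l1norm_nonneg abs_ge_self)
    finally show "norm (T as x) \<le> \<bar>C\<bar> * prod_list (map (l1norm G) as) * l1norm G x" .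
  qed simp
qed

text \<open>Slots are expanded from left to right; \<open>us\<close> collects those already replaced
  by basis vectors, so it must be general in the induction.\<close>

lemma cochain_expansion:
  assumes T: "cochain G n T" and "set us \<subseteq> l1 G" "set as \<subseteq> l1 G" "length us + length as = n"
    and x: "x \<in> aug_ideal G"
  shows "T (us @ as) x = ext G (\<lambda>gs. T (us @ map delta gs) x) as"
  using assms(2-4)
proof (induction as arbitrary: us)
  case (Cons a as)
  obtain C where C: "\<And>as x. set as \<subseteq> l1 G \<Longrightarrow> length as = n \<Longrightarrow> x \<in> aug_ideal G \<Longrightarrow>
    norm (T as x) \<le> C * prod_list (map (l1norm G) as) * l1norm G x"
    using cochain_bound[OF T] by metis
  let ?P = "\<lambda>as. prod_list (map (l1norm G) as)"
  have "T (us @ a # as) x = (\<Sum>\<^sub>\<infinity>g\<in>carrier G. a g * T (us @ delta g # as) x)"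
  proof (rule functional_expansion[of G "\<lambda>b. T (us @ b # as) x" "C * ?P us * ?P as * l1norm G x"])
    fix b assume "b \<in> l1 G"
    then show "norm (T (us @ b # as) x) \<le> C * ?P us * ?P as * l1norm G x * l1norm G b"
      using C[of "us @ b # as" x] Cons.prems x by (simp add: ac_simps)
  qed (use Cons.prems x in \<open>auto intro!: cochain_lin_slot[OF T]\<close>)
  moreover have "T (us @ delta g # as) x = ext G (\<lambda>gs. T (us @ delta g # map delta gs) x) as"
    if "g \<in> carrier G" for g
    using Cons.IH[of "us @ [delta g]"] Cons.prems that by simp
  ultimately show ?case by (simp cong: infsum_cong)
qed simp

context group
begin

lemma conv_delta_left:
  assumes "g \<in> carrier G"
  shows "conv G (delta g) f = (\<lambda>x. if x \<in> carrier G then f (inv g \<otimes> x) else 0)"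
  by (simp add: conv_def infsum_delta[OF assms] cong: if_cong)

lemma conv_delta_right:
  assumes "g \<in> carrier G"
  shows "conv G f (delta g) = (\<lambda>x. if x \<in> carrier G then f (x \<otimes> inv g) else 0)"
proof
  fix x
  have "(\<Sum>\<^sub>\<infinity>y\<in>carrier G. f y * delta g (inv y \<otimes> x)) = (\<Sum>\<^sub>\<infinity>y\<in>{x \<otimes> inv g}. f y)"
    if x: "x \<in> carrier G"
  proof (rule infsum_cong_neutral)
    fix y assume "y \<in> carrier G - {x \<otimes> inv g}"
    then have "inv y \<otimes> x \<noteq> g" using assms x
      by (metis DiffD1 DiffD2 inv_closed inv_inv inv_solve_right m_closed singletonI inv_solve_left)
    then show "f y * delta g (inv y \<otimes> x) = 0" by (simp add: delta_def)
  next
    fix y assume "y \<in> carrier G \<inter> {x \<otimes> inv g}"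
    then have "inv y \<otimes> x = g" using assms x by (simp add: inv_mult_group m_assoc)
    then show "f y * delta g (inv y \<otimes> x) = f y" by (simp add: delta_def)
  qed (use assms x in auto)
  then show "conv G f (delta g) x = (if x \<in> carrier G then f (x \<otimes> inv g) else 0)"
    by (simp add: conv_def)
qed

lemma delta_translate:
  assumes "g \<in> carrier G" "h \<in> carrier G" "x \<in> carrier G"
  shows "delta h (inv g \<otimes> x) = delta (g \<otimes> h) x" "delta h (x \<otimes> inv g) = delta (h \<otimes> g) x"
proof -
  have "inv g \<otimes> x = h \<longleftrightarrow> x = g \<otimes> h" "x \<otimes> inv g = h \<longleftrightarrow> x = h \<otimes> g"
    using assms by (auto simp: m_assoc) (simp_all add: m_assoc[symmetric])
  then show "delta h (inv g \<otimes> x) = delta (g \<otimes> h) x" "delta h (x \<otimes> inv g) = delta (h \<otimes> g) x"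
    by (simp_all add: delta_def)
qed

lemma delta_outside: "g \<in> carrier G \<Longrightarrow> x \<notin> carrier G \<Longrightarrow> delta g x = 0"
  by (auto simp: delta_def)

lemma conv_delta_delta:
  assumes "g \<in> carrier G" "h \<in> carrier G"
  shows "conv G (delta g) (delta h) = delta (g \<otimes> h)"
  using assms by (auto simp: conv_delta_left delta_translate delta_outside)

lemma conv_delta_diff:
  assumes "g \<in> carrier G" "y \<in> carrier G" "z \<in> carrier G"
  shows "conv G (delta g) (\<lambda>x. delta y x - delta z x) = (\<lambda>x. delta (g \<otimes> y) x - delta (g \<otimes> z) x)"
    and "conv G (\<lambda>x. delta y x - delta z x) (delta g) = (\<lambda>x. delta (y \<otimes> g) x - delta (z \<otimes> g) x)"
  using assms by (auto simp: conv_delta_left conv_delta_right delta_translate delta_outside)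

lemma delta_diff:
  assumes "y \<in> carrier G" "z \<in> carrier G"
  shows "(\<lambda>x. delta y x - delta z x) \<in> aug_ideal G"
    and "l1norm G (\<lambda>x. delta y x - delta z x) \<le> 2"
proof -
  have eq: "(\<lambda>x. delta y x - delta z x) = (\<lambda>x. (-1) * delta z x + delta y x)" by simp
  have d: "delta z \<in> l1 G" "delta y \<in> l1 G" using assms by simp_all
  have s: "(\<Sum>\<^sub>\<infinity>x\<in>carrier G. delta g x) = 1" if "g \<in> carrier G" for g
    using infsum_delta[OF that, of "\<lambda>_. 1"] by simp
  show "(\<lambda>x. delta y x - delta z x) \<in> aug_ideal G"
    unfolding eq aug_ideal_def using l1_lin[OF d, of "-1"] sum_lin[OF d, of "-1"] s assms by simp
  show "l1norm G (\<lambda>x. delta y x - delta z x) \<le> 2"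
    unfolding eq using l1norm_lin[OF d, of "-1"] assms by simp
qed

lemma map_delta_l1: "set gs \<subseteq> carrier G \<Longrightarrow> set (map delta gs) \<subseteq> l1 G"
  by auto

lemma prod_list_l1norm_delta:
  "set gs \<subseteq> carrier G \<Longrightarrow> prod_list (map (l1norm G) (map delta gs)) = 1"
  by (induction gs) simp_all

text \<open>The last entry of the list indexes the vector in I_0(G), the others the arguments of T;
  an n-cochain thus gives a function of n+1 group elements.\<close>

definition values_on_group :: "(('a \<Rightarrow> complex) list \<Rightarrow> ('a \<Rightarrow> complex) \<Rightarrow> complex) \<Rightarrow> 'a list \<Rightarrow> complex" where
  "values_on_group T gs =
     T (map delta (butlast gs)) (\<lambda>x. delta (last gs) x - delta (inv (lprod (butlast gs))) x)"

lemma values_snoc: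
  "values_on_group T (gs @ [y]) = T (map delta gs) (\<lambda>x. delta y x - delta (inv (lprod gs)) x)"
  by (simp add: values_on_group_def)

text \<open>The base point may vary with \<open>gs\<close>: the expansion on I_0(G) is applied for
  each \<open>gs\<close> separately and is valid for any base point.\<close>

lemma cochain_eq_ext:
  assumes T: "cochain G n T" and as: "set as \<subseteq> l1 G" "length as = n" and x: "x \<in> aug_ideal G"
  shows "T as x = ext G (values_on_group T) (as @ [x])"
proof -
  obtain C where C: "\<And>as x. set as \<subseteq> l1 G \<Longrightarrow> length as = n \<Longrightarrow> x \<in> aug_ideal G \<Longrightarrow>
    norm (T as x) \<le> C * prod_list (map (l1norm G) as) * l1norm G x"
    using cochain_bound[OF T] by metis
  have "T as x = ext G (\<lambda>gs. T (map delta gs) x) as"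
    using cochain_expansion[OF T, of "[]" as x] as x by simp
  also have "\<dots> = ext G (\<lambda>gs. ext G (\<lambda>hs. values_on_group T (gs @ hs)) [x]) as"
  proof (rule ext_cong)
    fix gs assume gs: "set gs \<subseteq> carrier G" "length gs = length as"
    have "T (map delta gs) x
        = (\<Sum>\<^sub>\<infinity>y\<in>carrier G. x y * T (map delta gs) (\<lambda>g. delta y g - delta (inv (lprod gs)) g))"
    proof (rule aug_functional_expansion)
      have "set (map delta gs) \<subseteq> l1 G" "length (map delta gs) = n"
        using map_delta_l1[OF gs(1)] gs as by simp_all
      note ds = this
      show "T (map delta gs) (\<lambda>g. c * a g + b g) = c * T (map delta gs) a + T (map delta gs) b"
        if "a \<in> aug_ideal G" "b \<in> aug_ideal G" for a b c
        by (rule cochain_lin[OF T ds that])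
      show "norm (T (map delta gs) a) \<le> C * prod_list (map (l1norm G) (map delta gs)) * l1norm G a"
        if "a \<in> aug_ideal G" for a
        by (rule C[OF ds that])
    qed (use gs x in simp_all)
    then show "T (map delta gs) x = ext G (\<lambda>hs. values_on_group T (gs @ hs)) [x]"
      by (simp add: values_snoc)
  qed
  finally show ?thesis by (simp add: ext_append)
qed

lemma values_bounded:
  assumes T: "cochain G n T"
  shows "\<exists>K. bdd_on_lists G (n + 1) (values_on_group T) K"
proof -
  obtain C where C: "C \<ge> 0" "\<And>as x. set as \<subseteq> l1 G \<Longrightarrow> length as = n \<Longrightarrow> x \<in> aug_ideal G \<Longrightarrow>
    norm (T as x) \<le> C * prod_list (map (l1norm G) as) * l1norm G x"
    using cochain_bound[OF T] by metis
  have "norm (values_on_group T gs) \<le> C * 2" if gs: "set gs \<subseteq> carrier G" "length gs = n + 1" for gs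
  proof -
    obtain us y where us: "gs = us @ [y]" using gs by (cases gs rule: rev_cases) auto
    then have g: "set us \<subseteq> carrier G" "length us = n" "y \<in> carrier G" "inv (lprod us) \<in> carrier G"
      using gs by auto
    have "norm (values_on_group T gs) \<le> C * 1 * l1norm G (\<lambda>x. delta y x - delta (inv (lprod us)) x)"
      unfolding us values_snoc prod_list_l1norm_delta[OF g(1), symmetric]
      by (rule C(2)) (use g map_delta_l1 delta_diff in auto)
    also have "\<dots> \<le> C * 1 * 2"
      by (intro mult_left_mono delta_diff) (use g C in auto)
    finally show ?thesis by simp
  qed
  then show ?thesis using C(1) unfolding bdd_on_lists_def by (intro exI[of _ "C * 2"]) auto
qed

lemma values_vanish:
  assumes T: "cochain G n T" and "set gs \<subseteq> carrier G" "length gs = n + 1" "lprod gs = \<one>"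
  shows "values_on_group T gs = 0"
proof -
  obtain us y where us: "gs = us @ [y]" using assms by (cases gs rule: rev_cases) auto
  then have g: "set us \<subseteq> carrier G" "length us = n" "y \<in> carrier G" using assms by auto
  then have "lprod us \<otimes> y = \<one>" using assms(4) us by simp
  then have y: "y = inv (lprod us)" using g by (metis inv_equality inv_inv lprod_closed)
  have z: "(\<lambda>x. 0) \<in> aug_ideal G" by (simp add: aug_ideal_def l1_def)
  \<comment> \<open>Here the vector is 0, and additivity in the form T0 = T0 + T0 gives the value
    0.\<close>
  then have "T (map delta us) (\<lambda>x. 1 * 0 + 0) = 1 * T (map delta us) (\<lambda>x. 0) + T (map delta us) (\<lambda>x. 0)"
    using g map_delta_l1[OF g(1)] by (intro cochain_lin[OF T]) auto
  then show ?thesis by (simp add: us values_snoc y)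
qed

text \<open>Each face sends the base point of the old tuple to that of the new one: z g inverts the
  product without its first factor g, l z inverts the product without its last factor l, and inner
  contractions leave the product unchanged.\<close>

lemma values_cocycle:
  assumes cocycle: "\<And>as x. set as \<subseteq> l1 G \<Longrightarrow> length as = n + 1 \<Longrightarrow> x \<in> aug_ideal G \<Longrightarrow> cobdry G n T as x = 0"
    and gs: "set gs \<subseteq> carrier G" "length gs = n + 2"
  shows "bdry (values_on_group T) gs = 0"
proof -
  obtain ks y where gsk: "gs = ks @ [y]" using gs by (cases gs rule: rev_cases) auto
  then have ks: "set ks \<subseteq> carrier G" "length ks = n + 1" "y \<in> carrier G" using gs by auto
  define z where "z = inv (lprod ks)"
  have z: "z \<in> carrier G" using ks by (simp add: z_def)
  let ?x = "\<lambda>x. delta y x - delta z x"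
  obtain g ks' where hd: "ks = g # ks'" using ks by (cases ks) auto
  obtain us l where last: "ks = us @ [l]" using ks by (cases ks rule: rev_cases) auto
  have us: "length us = n" "set us \<subseteq> carrier G" "l \<in> carrier G" using last ks by auto
  have hd': "g \<in> carrier G" "set ks' \<subseteq> carrier G" using hd ks by auto
  have first: "T (tl (map delta ks)) (conv G ?x (hd (map delta ks))) = values_on_group T (rot gs)"
  proof -
    have "z \<otimes> g = inv (lprod ks')" using hd' by (simp add: z_def hd inv_mult_group m_assoc)
    then show ?thesis using hd' ks z by (simp add: gsk hd values_snoc conv_delta_diff)
  qed
  have mid: "T (take i (map delta ks) @ [conv G (map delta ks ! i) (map delta ks ! (i + 1))]
        @ drop (i + 2) (map delta ks)) ?x = values_on_group T (contract i gs)" if "i < n" for i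
  proof -
    have "ks ! i \<in> carrier G" "ks ! (i + 1) \<in> carrier G" using ks that nth_mem by fastforce+
    then have "map delta (contract i ks) = take i (map delta ks)
        @ [conv G (map delta ks ! i) (map delta ks ! (i + 1))] @ drop (i + 2) (map delta ks)"
      using ks that by (simp add: contract_eq take_map drop_map conv_delta_delta)
    then show ?thesis using ks that
      by (simp add: gsk contract_append values_snoc lprod_contract z_def)
  qed
  have last_face: "T (take n (map delta ks)) (conv G (map delta ks ! n) ?x) = values_on_group T (contract n gs)"
  proof -
    have "l \<otimes> z = inv (lprod us)" using us
      by (simp add: z_def last inv_mult_group m_assoc[symmetric])
    moreover have "contract n gs = us @ [l \<otimes> y]"
      using contract_last[of us l y] us by (simp add: gsk last)
    moreover have "take n (map delta ks) = map delta us" "map delta ks ! n = delta l"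
      using us by (simp_all add: last nth_append)
    ultimately show ?thesis using us ks z by (simp add: values_snoc conv_delta_diff)
  qed
  have "0 = cobdry G n T (map delta ks) ?x"
    using cocycle[OF map_delta_l1[OF ks(1)] _ delta_diff(1)[OF ks(3) z]] ks by simp
  also have "\<dots> = values_on_group T (rot gs)
      + (\<Sum>i<n. (-1) ^ (i + 1) * values_on_group T (contract i gs))
      + (-1) ^ (n + 1) * values_on_group T (contract n gs)"
    unfolding cobdry_def first last_face using mid by simp
  also have "\<dots> = bdry (values_on_group T) gs" using gs by (simp add: bdry_def)
  finally show ?thesis by simp
qed

section \<open>From bounded functions on group tuples back to cochains\<close>

lemma ext_cochain:
  assumes "bdd_on_lists G (Suc k) s K"
  shows "cochain G k (\<lambda>as x. ext G s (as @ [x]))"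
  unfolding cochain_def
proof (intro conjI allI impI ballI)
  fix as :: "('a \<Rightarrow> complex) list" and i a b c x
  assume as: "set as \<subseteq> l1 G" "length as = k" and i: "i < k"
    and ab: "a \<in> l1 G" "b \<in> l1 G" and x: "x \<in> aug_ideal G"
  have "set (take i as) \<subseteq> l1 G" "set (drop (Suc i) as) \<subseteq> l1 G"
    using as set_take_subset set_drop_subset by fast+
  then show "ext G s (as[i := \<lambda>g. c * a g + b g] @ [x])
      = c * ext G s (as[i := a] @ [x]) + ext G s (as[i := b] @ [x])"
    using ext_slot_lin[of "take i as" G a b "drop (Suc i) as @ [x]" s K c] assms as i ab x
    by (simp add: upd_conv_take_nth_drop aug_ideal_l1)
next
  fix as :: "('a \<Rightarrow> complex) list" and x y c
  assume "set as \<subseteq> l1 G" "length as = k" "x \<in> aug_ideal G" "y \<in> aug_ideal G"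
  then show "ext G s (as @ [\<lambda>g. c * x g + y g]) = c * ext G s (as @ [x]) + ext G s (as @ [y])"
    using ext_slot_lin[of as G x y "[]" s K c] assms by (simp add: aug_ideal_l1)
next
  show "\<exists>C. \<forall>as. set as \<subseteq> l1 G \<longrightarrow> length as = k \<longrightarrow> (\<forall>x\<in>aug_ideal G.
      norm (ext G s (as @ [x])) \<le> C * prod_list (map (l1norm G) as) * l1norm G x)"
  proof (intro exI[of _ K] allI impI ballI)
    fix as x assume "set as \<subseteq> l1 G" "length as = k" "x \<in> aug_ideal G"
    then show "norm (ext G s (as @ [x])) \<le> K * prod_list (map (l1norm G) as) * l1norm G x"
      using ext_bound[of "as @ [x]" G s K] assms by (simp add: aug_ideal_l1 ac_simps)
  qed
qed

text \<open>Extension commutes with the coboundary, face by face: contractions become convolutions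
  by \<open>ext_contract\<close>, and the cyclic face also needs a rotation.\<close>

lemma ext_bdry:
  assumes s: "bdd_on_lists G (Suc k) s K" and as: "set as \<subseteq> l1 G" "length as = Suc k" and x: "x \<in> l1 G"
  shows "ext G (bdry s) (as @ [x]) = cobdry G k (\<lambda>as x. ext G s (as @ [x])) as x"
proof -
  obtain a us where a: "as = a # us" using as by (cases as) auto
  let ?L = "as @ [x]"
  have L: "set ?L \<subseteq> l1 G" "length ?L = Suc (Suc k)" using as x by auto
  have b_con: "bdd_on_lists G (length ?L) (\<lambda>gs. s (contract i gs)) K" if "i < Suc k" for i
    using s that L contract_length contract_carrier unfolding bdd_on_lists_def by simp
  \<comment> \<open>The cyclic face is a rotation followed by the contraction of the last two
    entries, so \<open>ext_rotate\<close> and \<open>ext_contract\<close> together handle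
    it.\<close>
  have rot_eq: "rot gs = contract k (tl gs @ [hd gs])" if len: "length gs = Suc (Suc k)" for gs
  proof -
    obtain g gs' where "gs = g # gs'" "gs' \<noteq> []" using len by (cases gs) fastforce+
    then obtain vs y where gs: "gs = g # vs @ [y]" by (metis append_butlast_last_id)
    then show ?thesis using that contract_last[of vs y g] by simp
  qed
  have b_rot: "bdd_on_lists G (length ?L) (\<lambda>gs. s (rot gs)) K"
    unfolding bdd_on_lists_def
  proof (intro conjI allI impI)
    show "0 \<le> K" using s by (simp add: bdd_on_lists_def)
    fix gs assume gs: "set gs \<subseteq> carrier G" "length gs = length ?L"
    then have "set (tl gs @ [hd gs]) \<subseteq> carrier G" "length (tl gs @ [hd gs]) = Suc (Suc k)"
      using L by (cases gs; auto)+
    then show "norm (s (rot gs)) \<le> K"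
      using s contract_length contract_carrier rot_eq gs L unfolding bdd_on_lists_def by simp
  qed
  have conv_con: "ext G (\<lambda>gs. s (contract i gs)) as'
      = ext G s (take i as' @ [conv G (as' ! i) (as' ! (i + 1))] @ drop (i + 2) as')"
    if "set as' \<subseteq> l1 G" "length as' = Suc (Suc k)" "i < Suc k" for i as'
    using that s by (intro ext_contract) auto
  have "ext G (\<lambda>gs. s (rot gs)) ?L = ext G (\<lambda>gs. s (contract k (tl gs @ [hd gs]))) (a # us @ [x])"
    unfolding a append_Cons by (rule ext_cong) (use rot_eq L a in auto)
  also have "\<dots> = ext G (\<lambda>gs. s (contract k gs)) ((us @ [x]) @ [a])"
    using as x a s contract_length contract_carrier
    by (intro ext_rotate[where K = K]) (auto simp: bdd_on_lists_def)
  also have "\<dots> = ext G s (us @ [conv G x a])"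
    using as a x by (subst conv_con) (auto simp: nth_append)
  finally have first: "ext G (\<lambda>gs. s (rot gs)) ?L = ext G s (tl as @ [conv G x (hd as)])"
    by (simp add: a)
  have mid: "ext G (\<lambda>gs. s (contract i gs)) ?L
     = ext G s ((take i as @ [conv G (as ! i) (as ! (i + 1))] @ drop (i + 2) as) @ [x])" if "i < k" for i
    using that as L by (subst conv_con) (auto simp: nth_append)
  have last: "ext G (\<lambda>gs. s (contract k gs)) ?L = ext G s (take k as @ [conv G (as ! k) x])"
    using as L by (subst conv_con) (auto simp: nth_append)
  note sum = ext_sum[OF L(1), of "{..<Suc k}" "\<lambda>i gs. s (contract i gs)" K "\<lambda>i. (-1) ^ (i + 1)"]
  have 1: "ext G (\<lambda>gs. \<Sum>i<Suc k. (-1) ^ (i + 1) * s (contract i gs)) ?L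
      = (\<Sum>i<Suc k. (-1) ^ (i + 1) * ext G (\<lambda>gs. s (contract i gs)) ?L)"
    using sum b_con by blast
  obtain K' where K': "bdd_on_lists G (length ?L) (\<lambda>gs. \<Sum>i<Suc k. (-1) ^ (i + 1) * s (contract i gs)) K'"
    using sum b_con by blast
  have "ext G (bdry s) ?L
      = ext G (\<lambda>gs. 1 * s (rot gs) + (\<Sum>i<Suc k. (-1) ^ (i + 1) * s (contract i gs))) ?L"
    by (rule ext_cong) (use L in \<open>simp add: bdry_def\<close>)
  also have "\<dots> = ext G (\<lambda>gs. s (rot gs)) ?L
      + (\<Sum>i<Suc k. (-1) ^ (i + 1) * ext G (\<lambda>gs. s (contract i gs)) ?L)"
    using ext_lin[OF L(1) b_rot K', of 1] 1 by simp
  also have "\<dots> = cobdry G k (\<lambda>as x. ext G s (as @ [x])) as x"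
    unfolding cobdry_def first sum.lessThan_Suc last using mid by simp
  finally show ?thesis .
qed

end

theorem theorem3p5:
  fixes G :: "('g, 'b) monoid_scheme"
    and n :: nat
    and T :: "('g \<Rightarrow> complex) list \<Rightarrow> ('g \<Rightarrow> complex) \<Rightarrow> complex"
  assumes "group G"
    and "comm_transitive G"
    and "n \<ge> 1"
    and "cochain G n T"
    and "\<forall>as. set as \<subseteq> l1 G \<longrightarrow> length as = n + 1 \<longrightarrow>
           (\<forall>x\<in>aug_ideal G. cobdry G n T as x = 0)"
  shows "\<exists>S. cochain G (n - 1) S \<and>
           (\<forall>as. set as \<subseteq> l1 G \<longrightarrow> length as = n \<longrightarrow>
              (\<forall>x\<in>aug_ideal G. T as x = cobdry G (n - 1) S as x))"
proof -
  interpret group G by fact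
  obtain K where K: "bdd_on_lists G (n + 1) (values_on_group T) K"
    using values_bounded[OF assms(4)] by blast
  have "bdry (values_on_group T) gs = 0" if "set gs \<subseteq> carrier G" "length gs = n + 2" for gs
    using assms(5) that by (intro values_cocycle) auto
  then obtain s where s: "bdd_on_lists G n s K"
    and bdry: "\<And>gs. set gs \<subseteq> carrier G \<Longrightarrow> length gs = n + 1 \<Longrightarrow> values_on_group T gs = bdry s gs"
    using coboundary_of_cyclic_cocycle[OF assms(2,3) K _ values_vanish[OF assms(4)]] by blast
  \<comment> \<open>Of the n group entries of \<open>s\<close>, the last belongs to the I_0(G) slot;
    this leaves n-1 arguments, the degree of the cochain sought.\<close>
  have s': "bdd_on_lists G (Suc (n - 1)) s K" using s assms(3) by simp
  have "T as x = cobdry G (n - 1) (\<lambda>as x. ext G s (as @ [x])) as x"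
    if as: "set as \<subseteq> l1 G" "length as = n" and x: "x \<in> aug_ideal G" for as x
  proof -
    have "T as x = ext G (values_on_group T) (as @ [x])"
      by (rule cochain_eq_ext[OF assms(4) as x])
    also have "\<dots> = ext G (bdry s) (as @ [x])"
      by (rule ext_cong) (use bdry as in simp)
    also have "\<dots> = cobdry G (n - 1) (\<lambda>as x. ext G s (as @ [x])) as x"
      using as assms(3) aug_ideal_l1[OF x] by (intro ext_bdry[OF s']) auto
    finally show ?thesis .
  qed
  then show ?thesis using ext_cochain[OF s'] by blast
qed

end
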